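(* Fix $\nu$. Suppose the error assumptions (E1)–(E7) and the regressor condition (R) hold, and $|x_{tj}\epsilon_t^{(\nu')}|\le1$ for all $t$, all $j=1,\dots,p$ and all $\nu'\ge1$. Then $\widehat{\boldsymbol\beta}_{T\nu}\to\boldsymbol\beta_\nu$ in probability as $T,p\to\infty$, provided \[ \log(p)\sqrt p=o\big(\log^{1-a}(T)\big) \] for some $0<a<1$.
   Context: Setting: $p=p_T$ may grow with $T$. Regressors $\mathbf x_t\in\mathbb R^p$, spatial locations $\mathbf s_t\in[0,1]^q$, responses $Y_t^{(\nu)}=\mathbf x_t^\top\boldsymbol\beta_\nu+\epsilon_t^{(\nu)}$, $\nu=1,\dots,d$, $t=1,\dots,T$. $\mathbb P$ is conditional on the regressors. $\mathbb X_T=(\mathbf x_1,\dots,\mathbf x_T)^\top$ full rank, $\widehat{\boldsymbol\beta}_{T\nu}=(\mathbb X_T^\top\mathbb X_T)^{-1}\mathbb X_T^\top(Y_1^{(\nu)},\dots,Y_T^{(\nu)})^\top$. (R): regressors bounded; there exist positive definite $\Sigma_{\mathbf x}$, $\eta\ge0$, $C<\infty$, compact interval $A\subset(0,\infty)$, independent of $T,p$, with $\|T^{-1}\sum_t\mathbf x_t\mathbf x_t^\top-\Sigma_{\mathbf x}\|_2\le Cp^\eta/\sqrt T$ and $\operatorname{spec}(T^{-1}\mathbb X_T^\top\mathbb X_T)\subset A$. Error model: $\boldsymbol\epsilon_t=\mathbf H(\mathbf U_t(\mathbf s_t),\dots,\mathbf U_{t-m}(\mathbf s_t))-\mathbb E\,\mathbf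 H(\mathbf U_t(\mathbf s_t),\dots,\mathbf U_{t-m}(\mathbf s_t))$, $m\in\mathbb N_0$ fixed, $\mathbf H=(H_1,\dots,H_d):\mathbb R^{d\times(m+1)}\to\mathbb R^d$; the $\nu$th coordinate of $\mathbf U_t(\mathbf s)$ is $\sum_{\ell=1}^L\phi_{\nu\ell}d(\mathbf s,\mathbf r_\ell)F_t^{(\ell,\nu)}+E_t^{(\nu)}$ with fixed $L$, real $\phi_{\nu\ell}$, sites $\mathbf r_\ell\in[0,1]^q$, a function $d:[0,1]^q\times[0,1]^q\to[0,1]$, $\mathbf F_t^{(\ell)}=\sum_{j\ge0}\mathbb C_j^{(\ell)}\boldsymbol\varepsilon_{t-j}^{(\ell)}$, $\mathbf E_t=\sum_{j\ge0}\mathbb C_j^{(0)}\boldsymbol\varepsilon_{t-j}^{(0)}$, $d\times d$ matrices $\mathbb C_j^{(\ell)}$ with rows $\mathbf c_j^{(\ell,\nu)\top}$; $\varepsilon_t^{(\ell,\nu)}$ is the $\nu$th coordinate of $\boldsymbol\varepsilon_t^{(\ell)}$. (E1) $\{\boldsymbol\varepsilon_t^{(\ell)}\}_t$, $\ell=0,\dots,L$, mutually independent sequences of independent mean zero vectors $\boldsymbol\varepsilon_t^{(\ell)}=\Sigma_{\varepsilon,t}^{(\ell)1/2}\mathbf u_t^{(\ell)}$, $\Sigma_{\varepsilon,t}^{(\ell)}$ symmetric positive definite, $\mathbf u_t^{(\ell)}$ mean zero with independent coordinates. (E2) $\sup_t\max_\ell\max_\nu\mathbb E|\varepsilon_t^{(\ell,\nu)}|^{2+\delta}<\infty$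 for some $\delta>0$. (E3) If $d=1$: $\sup_t\max_\ell\mathbb E(\varepsilon_t^{(\ell)})^2<\infty$. (E4) If $d=1$: $\mathbb E(\varepsilon_t^{(0)})^2\ge\underline\sigma_0^2>0$; if $d>1$: $\lambda_{\min}(\Sigma_{\varepsilon,t}^{(0)})\ge\underline\lambda>0$. (E5) $\varepsilon_t^{(\ell,\nu)}$ has density $p_t^{(\ell,\nu)}$ with $\sup_t\int|p_t^{(\ell,\nu)}(z+x)-p_t^{(\ell,\nu)}(z)|dz=O(|x|)$. (E6) $\max_\ell\max_\nu\|\mathbf c_j^{(\ell,\nu)}\|_\infty\le C\max(j,1)^{-7/2-\theta}$, some $\theta>0$. (E7) each $H_\nu$ is $L_H$-Lipschitz w.r.t. the Frobenius norm, and some random $d\times(m+1)$ matrix $\Xi$ independent of $\{\mathbf U_t\}$ has $\sup_\nu\mathbb E|H_\nu(\Xi)|^{2+\delta}<\infty$. *)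

theory Defs
  imports "HOL-Probability.Probability" "HOL-Library.Landau_Symbols"
begin

text \<open>Matrices and vectors of size n are represented as functions on nat,
  only the entries with indices below n are relevant.\<close>

definition sym_mat :: "nat \<Rightarrow> (nat \<Rightarrow> nat \<Rightarrow> real) \<Rightarrow> bool" where
  "sym_mat n A \<longleftrightarrow> (\<forall>i<n. \<forall>j<n. A i j = A j i)"

definition pos_def :: "nat \<Rightarrow> (nat \<Rightarrow> nat \<Rightarrow> real) \<Rightarrow> bool" where
  "pos_def n A \<longleftrightarrow> sym_mat n A \<and>
     (\<forall>v. (\<exists>i<n. v i \<noteq> 0) \<longrightarrow> (\<Sum>i<n. \<Sum>j<n. v i * A i j * v j) > 0)"

definition is_eigenvalue :: "nat \<Rightarrow> (nat \<Rightarrow> nat \<Rightarrow> real) \<Rightarrow> real \<Rightarrow> bool" where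
  "is_eigenvalue n A k \<longleftrightarrow>
     (\<exists>v. (\<exists>i<n. v i \<noteq> 0) \<and> (\<forall>i<n. (\<Sum>j<n. A i j * v j) = k * v i))"

definition op_norm2 :: "nat \<Rightarrow> (nat \<Rightarrow> nat \<Rightarrow> real) \<Rightarrow> real" where
  "op_norm2 n A = Sup {sqrt (\<Sum>i<n. (\<Sum>j<n. A i j * v j)\<^sup>2) | v. (\<Sum>j<n. (v j)\<^sup>2) \<le> 1}"

definition mat_is_inv :: "nat \<Rightarrow> (nat \<Rightarrow> nat \<Rightarrow> real) \<Rightarrow> (nat \<Rightarrow> nat \<Rightarrow> real) \<Rightarrow> bool" where
  "mat_is_inv n A B \<longleftrightarrow>
     (\<forall>i<n. \<forall>j<n. (\<Sum>k<n. A i k * B k j) = (if i = j then 1 else 0)) \<and>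
     (\<forall>i<n. \<forall>j<n. (\<Sum>k<n. B i k * A k j) = (if i = j then 1 else 0)) \<and>
     (\<forall>i j. \<not> (i < n \<and> j < n) \<longrightarrow> B i j = 0)"

definition matinv :: "nat \<Rightarrow> (nat \<Rightarrow> nat \<Rightarrow> real) \<Rightarrow> (nat \<Rightarrow> nat \<Rightarrow> real)" where
  "matinv n A = (THE B. mat_is_inv n A B)"

definition gram :: "nat \<Rightarrow> (nat \<Rightarrow> nat \<Rightarrow> real) \<Rightarrow> nat \<Rightarrow> nat \<Rightarrow> real" where
  "gram T x = (\<lambda>i j. \<Sum>t=1..T. x t i * x t j)"

definition full_col_rank :: "nat \<Rightarrow> nat \<Rightarrow> (nat \<Rightarrow> nat \<Rightarrow> real) \<Rightarrow> bool" where
  "full_col_rank T p x \<longleftrightarrow>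
     (\<forall>b. (\<forall>t\<in>{1..T}. (\<Sum>j<p. x t j * b j) = 0) \<longrightarrow> (\<forall>j<p. b j = 0))"

definition ols :: "nat \<Rightarrow> nat \<Rightarrow> (nat \<Rightarrow> nat \<Rightarrow> real) \<Rightarrow> (nat \<Rightarrow> real) \<Rightarrow> nat \<Rightarrow> real" where
  "ols T p x Y = (\<lambda>i. \<Sum>j<p. matinv p (gram T x) i j * (\<Sum>t=1..T. x t j * Y t))"

definition lin_proc :: "nat \<Rightarrow> (nat \<Rightarrow> nat \<Rightarrow> nat \<Rightarrow> real) \<Rightarrow> (int \<Rightarrow> 'a \<Rightarrow> nat \<Rightarrow> real)
    \<Rightarrow> int \<Rightarrow> 'a \<Rightarrow> nat \<Rightarrow> real" where
  "lin_proc d C e t \<omega> \<nu> = (\<Sum>j. \<Sum>k<d. C j \<nu> k * e (t - int j) \<omega> k)"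

end

theory Submission
  imports Defs "Jordan_Normal_Form.Determinant" "HOL-Real_Asymp.Real_Asymp"
begin

text \<open>The estimation error b solves the normal equations for the errors, so
  \<open>|b| \<le> |X\<^sup>T \<epsilon>| / (a\<^sub>1 T)\<close>, where \<open>a\<^sub>1\<close> bounds the spectrum of \<open>X\<^sup>T X / T\<close> from below.
  It remains to bound the second moment of each of the p coordinates of \<open>X\<^sup>T \<epsilon>\<close>. Cutting the
  linear processes off after n lags changes each error by \<open>O(1/n)\<close> in mean square and makes the
  errors (n + m)-dependent, so the second moment is \<open>O(T n + T\<^sup>2 / n\<^sup>2)\<close>, which is
  \<open>O(T\<^bsup>3/2\<^esup>)\<close> for n of order \<open>\<surd>T\<close>. The growth condition forces \<open>p \<le> (ln T)\<^sup>2\<close>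
  eventually, and Markov's inequality gives the probability bound \<open>O(p / \<surd>T)\<close>, which vanishes.\<close>

section \<open>Least eigenvalue and least squares error\<close>

text \<open>Each error depends on the whole past of the innovations, so its covariances are not
  directly under control. Truncated errors are exactly independent once their times are n + m apart.
  The remainders stay dependent, and Cauchy-Schwarz over T of them costs the factor
  \<open>T^2\<close>. Equating \<open>T n\<close> with \<open>T^2 / n^2\<close> would suggest
  \<open>n = T^(1/3)\<close>; order \<open>sqrt T\<close> is simpler and still leaves ample room for
  a dimension bounded by \<open>(ln T)^2\<close>. A recurring obstacle is that
  \<open>lin_proc\<close> is a \<open>suminf\<close>, whose value carries no information where the
  series diverges. Almost sure convergence must therefore come before any comparison of two
  processes. The least squares part, by contrast, is deterministic and is applied outcome by
  outcome.\<close>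

lemma compact_unit_sphere_fun:
  "compact {v :: nat \<Rightarrow> real. (\<forall>i\<ge>n. v i = 0) \<and> (\<Sum>i<n. (v i)\<^sup>2) = 1}" (is "compact ?S")
proof -
  \<comment> \<open>With the coordinates from n on pinned to 0, the sphere is a closed subset of a
    product of compact intervals, which is compact by Tychonoff.\<close>
  define I where "I i = (if i < n then {-1..1::real} else {0})" for i :: nat
  have "compactin (product_topology (\<lambda>i::nat. euclidean) UNIV) (PiE UNIV I)"
    by (subst compactin_PiE) (auto simp: I_def compactin_euclidean_iff)
  then have "compact (PiE UNIV I)"
    by (simp add: euclidean_product_topology compactin_euclidean_iff)
  moreover have "closed ?S"
  proof -
    have "?S = (\<Inter>i\<in>{n..}. {v. v i = 0}) \<inter> {v. (\<Sum>i<n. (v i)\<^sup>2) = 1}"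
      by auto
    moreover have "closed {v :: nat \<Rightarrow> real. v i = 0}" for i
      by (intro closed_Collect_eq continuous_intros) auto
    moreover have "closed {v :: nat \<Rightarrow> real. (\<Sum>i<n. (v i)\<^sup>2) = 1}"
      by (intro closed_Collect_eq continuous_intros) auto
    ultimately show ?thesis
      by (simp add: closed_Int closed_INT)
  qed
  moreover have "?S \<subseteq> PiE UNIV I"
  proof
    fix v assume v: "v \<in> ?S"
    have "v i \<in> {-1..1}" if "i < n" for i
    proof -
      have "(v i)\<^sup>2 \<le> (\<Sum>i<n. (v i)\<^sup>2)"
        using that by (intro member_le_sum) auto
      with v have "(v i)\<^sup>2 \<le> 1" by simp
      then show ?thesis
        by (simp add: abs_square_le_1 abs_le_iff)
    qed
    with v show "v \<in> PiE UNIV I"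
      by (auto simp: I_def PiE_iff)
  qed
  ultimately have "compact (PiE UNIV I \<inter> ?S)"
    by (intro compact_Int_closed)
  with \<open>?S \<subseteq> PiE UNIV I\<close> show ?thesis
    by (simp add: Int_absorb1)
qed

lemma nonneg_quadratic_imp_linear_coeff_zero:
  fixes a b :: real
  assumes "\<And>t. 0 \<le> 2 * t * b + t\<^sup>2 * a"
  shows "b = 0"
proof (rule ccontr)
  assume b: "b \<noteq> 0"
  \<comment> \<open>The value at \<open>t = - b / k\<close> is
    \<open>(b / k)^2 * (a - 2 * k)\<close>, which is negative as soon as k is positive and exceeds
    a.\<close>
  define k where "k = \<bar>a\<bar> + 1"
  have k: "k > 0" "a < k" by (auto simp: k_def)
  have "0 \<le> 2 * (- b / k) * b + (- b / k)\<^sup>2 * a" by (rule assms)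
  also have "\<dots> = (b / k)\<^sup>2 * (a - 2 * k)"
    using k by (simp add: field_simps power2_eq_square)
  also have "\<dots> < 0"
    using k b by (intro mult_pos_neg) auto
  finally show False by simp
qed

section \<open>Quadratic forms and the Rayleigh quotient\<close>

definition qform :: "nat \<Rightarrow> (nat \<Rightarrow> nat \<Rightarrow> real) \<Rightarrow> (nat \<Rightarrow> real) \<Rightarrow> real" where
  "qform n A v = (\<Sum>i<n. \<Sum>j<n. v i * A i j * v j)"

lemma qform_eq_sum_mult: "qform n A v = (\<Sum>i<n. v i * (\<Sum>j<n. A i j * v j))"
  by (simp add: qform_def sum_distrib_left mult.assoc)

lemma qform_add_scaled:
  assumes "sym_mat n A"
  shows "qform n A (\<lambda>i. v i + t * w i) =
    qform n A v + 2 * t * (\<Sum>i<n. w i * (\<Sum>j<n. A i j * v j)) + t\<^sup>2 * qform n A w"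
proof -
  have "(\<Sum>i<n. \<Sum>j<n. v i * A i j * w j) = (\<Sum>i<n. \<Sum>j<n. w i * A i j * v j)"
    using assms by (subst sum.swap) (auto simp: sym_mat_def intro!: sum.cong)
  then have "qform n A (\<lambda>i. v i + t * w i) = qform n A v
      + t * (\<Sum>i<n. \<Sum>j<n. w i * A i j * v j) + t * (\<Sum>i<n. \<Sum>j<n. w i * A i j * v j)
      + t\<^sup>2 * qform n A w"
    unfolding qform_def
    by (simp add: algebra_simps sum.distrib power2_eq_square sum_distrib_left[symmetric])
  then show ?thesis
    by (simp add: sum_distrib_left algebra_simps)
qed

text \<open>A minimiser of the quadratic form on the unit sphere is an eigenvector, because the
  first-order term of the form in every direction vanishes there.\<close>

lemma qform_ge_least_eigenvalue:
  assumes sym: "sym_mat n A" and ev: "\<And>k. is_eigenvalue n A k \<Longrightarrow> a \<le> k"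
  shows "a * (\<Sum>i<n. (v i)\<^sup>2) \<le> qform n A v"
proof (cases "\<exists>i<n. v i \<noteq> 0")
  case False
  then show ?thesis by (simp add: qform_def)
next
  case True
  let ?S = "{v :: nat \<Rightarrow> real. (\<forall>i\<ge>n. v i = 0) \<and> (\<Sum>i<n. (v i)\<^sup>2) = 1}"
  define nrm where "nrm w = sqrt (\<Sum>i<n. (w i)\<^sup>2)" for w :: "nat \<Rightarrow> real"
  \<comment> \<open>Besides normalising, this clears the coordinates from n on, as membership in
    \<open>?S\<close> demands.\<close>
  define unit where "unit w i = (if i < n then w i / nrm w else 0)" for w and i :: nat
  have nrm_pos: "nrm w > 0" if "\<exists>i<n. w i \<noteq> 0" for w
  proof -
    have "(\<Sum>i<n. (w i)\<^sup>2) > 0"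
      using that by (auto intro!: sum_pos2)
    then show ?thesis by (simp add: nrm_def)
  qed
  have nrm_sq: "(nrm w)\<^sup>2 = (\<Sum>i<n. (w i)\<^sup>2)" for w
    by (simp add: nrm_def sum_nonneg)
  have unit: "unit w \<in> ?S" if "\<exists>i<n. w i \<noteq> 0" for w
  proof -
    have "(\<Sum>i<n. (unit w i)\<^sup>2) = (\<Sum>i<n. (w i)\<^sup>2) / (nrm w)\<^sup>2"
      by (simp add: unit_def power_divide sum_divide_distrib)
    also have "\<dots> = 1"
      using nrm_pos[OF that] by (simp add: nrm_sq[symmetric])
    finally show ?thesis by (simp add: unit_def)
  qed
  have qform_unit: "qform n A (unit w) = qform n A w / (nrm w)\<^sup>2" for w
    by (auto simp: qform_def unit_def sum_divide_distrib power2_eq_square intro!: sum.cong)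
  have cont: "continuous_on ?S (qform n A)"
    unfolding qform_def
    by (intro continuous_intros continuous_on_subset[OF continuous_on_product_coordinates]) auto
  obtain z where z: "z \<in> ?S" and zmin: "\<And>w. w \<in> ?S \<Longrightarrow> qform n A z \<le> qform n A w"
    using continuous_attains_inf[OF compact_unit_sphere_fun _ cont] unit[OF True] by blast
  define \<mu> where "\<mu> = qform n A z"
  \<comment> \<open>Homogeneity carries minimality from the sphere to all vectors, so perturbed
    vectors below need not be normalised again.\<close>
  have min: "\<mu> * (\<Sum>i<n. (w i)\<^sup>2) \<le> qform n A w" for w
  proof (cases "\<exists>i<n. w i \<noteq> 0")
    case w: True
    have "\<mu> \<le> qform n A w / (nrm w)\<^sup>2"
      using zmin[OF unit[OF w]] by (simp add: \<mu>_def qform_unit)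
    then show ?thesis
      using nrm_pos[OF w] by (simp add: nrm_sq[symmetric] pos_le_divide_eq)
  qed (simp add: qform_def)
  have "(\<Sum>j<n. A i j * z j) = \<mu> * z i" if i: "i < n" for i
  proof -
    \<comment> \<open>Perturbing z in the i-th coordinate direction isolates the i-th row of the
      eigenvalue equation as a first-order coefficient.\<close>
    define w where "w j = (if j = i then 1 else 0::real)" for j
    have w_sum: "(\<Sum>j<n. w j * g j) = g i" for g
      using i by (simp add: w_def if_distrib[where f="\<lambda>c. c * _"] sum.delta cong: if_cong)
    have "0 \<le> 2 * t * ((\<Sum>j<n. A i j * z j) - \<mu> * z i) + t\<^sup>2 * (qform n A w - \<mu>)" for t
    proof -
      have "(\<Sum>j<n. (z j + t * w j)\<^sup>2) = (\<Sum>j<n. (z j)\<^sup>2) + 2 * t * (\<Sum>j<n. w j * z j)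
          + t\<^sup>2 * (\<Sum>j<n. w j * w j)"
        by (simp add: power2_eq_square algebra_simps sum.distrib sum_distrib_left)
      also have "\<dots> = 1 + 2 * t * z i + t\<^sup>2"
        using z by (simp add: w_sum) (simp add: w_def)
      finally have "\<mu> * (1 + 2 * t * z i + t\<^sup>2) \<le> qform n A (\<lambda>j. z j + t * w j)"
        using min[of "\<lambda>j. z j + t * w j"] by simp
      also have "\<dots> = \<mu> + 2 * t * (\<Sum>j<n. A i j * z j) + t\<^sup>2 * qform n A w"
        by (simp add: qform_add_scaled[OF sym] w_sum \<mu>_def)
      finally show ?thesis by (simp add: algebra_simps)
    qed
    from nonneg_quadratic_imp_linear_coeff_zero[OF this] show ?thesis by simp
  qed
  moreover have "\<exists>i<n. z i \<noteq> 0"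
  proof (rule ccontr)
    assume "\<not> (\<exists>i<n. z i \<noteq> 0)"
    then have "(\<Sum>i<n. (z i)\<^sup>2) = 0" by simp
    with z show False by simp
  qed
  ultimately have "is_eigenvalue n A \<mu>"
    unfolding is_eigenvalue_def by blast
  then have "a * (\<Sum>i<n. (v i)\<^sup>2) \<le> \<mu> * (\<Sum>i<n. (v i)\<^sup>2)"
    by (intro mult_right_mono ev sum_nonneg) auto
  also note min
  finally show ?thesis .
qed

text \<open>A trivial kernel forces a nonzero determinant, and the adjugate divided by the
  determinant is then a two-sided inverse.\<close>

lemma mat_is_inv_exists:
  assumes inj: "\<And>v. (\<And>i. i < n \<Longrightarrow> (\<Sum>j<n. A i j * v j) = 0) \<Longrightarrow> (\<And>i. i < n \<Longrightarrow> v i = 0)"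
  shows "\<exists>B. mat_is_inv n A B"
proof -
  define A' where "A' = mat n n (\<lambda>(i, j). A i j)"
  have A': "A' \<in> carrier_mat n n" by (simp add: A'_def)
  have "Determinant.det A' \<noteq> 0"
  proof
    assume "Determinant.det A' = 0"
    then obtain v where v: "v \<in> carrier_vec n" "v \<noteq> 0\<^sub>v n" "A' *\<^sub>v v = 0\<^sub>v n"
      using det_0_iff_vec_prod_zero_field[OF A'] by blast
    have "(\<Sum>j<n. A i j * vec_index v j) = 0" if "i < n" for i
    proof -
      have "vec_index (A' *\<^sub>v v) i = (\<Sum>j<n. A i j * vec_index v j)"
        using that v(1) by (auto simp: A'_def scalar_prod_def atLeast0LessThan intro!: sum.cong)
      with v(3) that show ?thesis by simp
    qed
    then have "vec_index v i = 0" if "i < n" for i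
      using inj[of "vec_index v"] that by blast
    with v(1) have "v = 0\<^sub>v n" by (intro eq_vecI) auto
    with v(2) show False ..
  qed
  define D where "D = inverse (Determinant.det A') \<cdot>\<^sub>m adj_mat A'"
  have D: "D \<in> carrier_mat n n" using adj_mat(1)[OF A'] by (simp add: D_def)
  have "A' * D = 1\<^sub>m n" "D * A' = 1\<^sub>m n"
    using adj_mat[OF A'] A' \<open>Determinant.det A' \<noteq> 0\<close>
    by (auto simp: D_def mult_smult_distrib mult_smult_assoc_mat intro!: eq_matI)
  then have eq: "(A' * D) $$ (i, j) = (if i = j then 1 else 0)"
      "(D * A') $$ (i, j) = (if i = j then 1 else 0)" if "i < n" "j < n" for i j
    using that by auto
  \<comment> \<open>\<open>mat_is_inv\<close> prescribes zeros outside the n by n block, which makes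
    the inverse unique as a function on all indices.\<close>
  define B where "B i j = (if i < n \<and> j < n then D $$ (i, j) else 0)" for i j
  have "(\<Sum>k<n. A i k * B k j) = (A' * D) $$ (i, j)"
    "(\<Sum>k<n. B i k * A k j) = (D * A') $$ (i, j)" if "i < n" "j < n" for i j
    using that A' D
    by (auto simp: B_def A'_def scalar_prod_def atLeast0LessThan intro!: sum.cong)
  with eq have "mat_is_inv n A B"
    by (simp add: mat_is_inv_def) (simp add: B_def)
  then show ?thesis by blast
qed

text \<open>\<open>matinv\<close> is a definite description, so uniqueness is needed: on the block
  \<open>B' = B' (A B) = (B' A) B = B\<close>, and elsewhere both are 0.\<close>

lemma mat_is_inv_matinv:
  assumes "mat_is_inv n A B"
  shows "mat_is_inv n A (matinv n A)"
  unfolding matinv_def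
proof (rule theI[where a = B])
  show "mat_is_inv n A B" by fact
  fix B' assume B': "mat_is_inv n A B'"
  have "B' i j = B i j" if ij: "i < n" "j < n" for i j
  proof -
    have "B' i j = (\<Sum>k<n. B' i k * (if k = j then 1 else 0))"
      using ij by (simp add: sum.delta if_distrib[where f="\<lambda>c. _ * c"] cong: if_cong)
    also have "\<dots> = (\<Sum>k<n. B' i k * (\<Sum>l<n. A k l * B l j))"
      using assms ij by (intro sum.cong) (auto simp: mat_is_inv_def)
    also have "\<dots> = (\<Sum>l<n. (\<Sum>k<n. B' i k * A k l) * B l j)"
      by (simp add: sum_distrib_left sum_distrib_right mult.assoc) (rule sum.swap)
    also have "\<dots> = (\<Sum>l<n. (if i = l then 1 else 0) * B l j)"
      using B' ij by (intro sum.cong) (auto simp: mat_is_inv_def)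
    also have "\<dots> = B i j"
      using ij by (simp add: sum.delta' if_distrib[where f="\<lambda>c. c * _"] cong: if_cong)
    finally show ?thesis .
  qed
  moreover have "B' i j = B i j" if "\<not> (i < n \<and> j < n)" for i j
    using that assms B' by (simp add: mat_is_inv_def)
  ultimately show "B' = B" by (intro ext) metis
qed

section \<open>Normal equations for the estimation error\<close>

lemma sym_mat_gram: "sym_mat n (gram T x)"
  by (simp add: sym_mat_def gram_def mult.commute)

text \<open>With G the Gram matrix, b the estimation error and \<open>w = X^T e\<close>, the normal
  equations read \<open>G b = w\<close>. Hence \<open>a T |b|^2\<close> is at most
  \<open>b^T G b\<close>, which equals the inner product of b and w and is at most
  \<open>|b| |w|\<close>; cancelling \<open>|b|\<close> gives the bound.\<close>

lemma ols_error_bound: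
  fixes x :: "nat \<Rightarrow> nat \<Rightarrow> real" and \<beta> e :: "nat \<Rightarrow> real"
  assumes T: "T \<ge> 1" and a: "a > 0"
    and ev: "\<And>k. is_eigenvalue p (\<lambda>i j. gram T x i j / real T) k \<Longrightarrow> a \<le> k"
  shows "(\<Sum>j<p. (ols T p x (\<lambda>t. (\<Sum>i<p. x t i * \<beta> i) + e t) j - \<beta> j)\<^sup>2)
    \<le> (\<Sum>j<p. (\<Sum>t=1..T. x t j * e t)\<^sup>2) / (a * real T)\<^sup>2"
proof -
  let ?G = "gram T x"
  define b where "b j = ols T p x (\<lambda>t. (\<Sum>i<p. x t i * \<beta> i) + e t) j - \<beta> j" for j
  define w where "w j = (\<Sum>t=1..T. x t j * e t)" for j
  have ge: "a * real T * (\<Sum>i<p. (v i)\<^sup>2) \<le> qform p ?G v" for v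
  proof -
    have "sym_mat p (\<lambda>i j. ?G i j / real T)"
      using sym_mat_gram[of p T x] by (simp add: sym_mat_def)
    from qform_ge_least_eigenvalue[OF this ev]
    have "a * (\<Sum>i<p. (v i)\<^sup>2) \<le> qform p (\<lambda>i j. ?G i j / real T) v" .
    also have "\<dots> = qform p ?G v / real T"
      by (simp add: qform_def sum_divide_distrib)
    finally show ?thesis using T by (simp add: field_simps)
  qed
  \<comment> \<open>The lower bound \<open>ge\<close> already excludes a nontrivial kernel of the
    Gram matrix.\<close>
  have "\<exists>B. mat_is_inv p ?G B"
  proof (rule mat_is_inv_exists)
    fix v i assume v: "\<And>i. i < p \<Longrightarrow> (\<Sum>j<p. ?G i j * v j) = 0" and i: "i < p"
    have "a * real T * (\<Sum>i<p. (v i)\<^sup>2) \<le> 0"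
      using ge[of v] v by (simp add: qform_eq_sum_mult)
    then have "(\<Sum>i<p. (v i)\<^sup>2) \<le> 0"
      using a T by (simp add: mult_le_0_iff)
    then have "(\<Sum>i<p. (v i)\<^sup>2) = 0"
      by (intro antisym sum_nonneg) auto
    with i show "v i = 0" by (simp add: sum_nonneg_eq_0_iff)
  qed
  then have inv: "mat_is_inv p ?G (matinv p ?G)"
    using mat_is_inv_matinv by blast
  have Gb: "(\<Sum>j<p. ?G i j * b j) = w i" if i: "i < p" for i
  proof -
    define c where "c k = (\<Sum>t=1..T. x t k * ((\<Sum>i<p. x t i * \<beta> i) + e t))" for k
    have c: "c k = (\<Sum>j<p. ?G k j * \<beta> j) + w k" for k
      by (simp add: c_def w_def gram_def algebra_simps sum.distrib sum_distrib_left sum_distrib_right)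
         (rule sum.swap)
    have "(\<Sum>j<p. ?G i j * ols T p x (\<lambda>t. (\<Sum>i<p. x t i * \<beta> i) + e t) j)
        = (\<Sum>j<p. ?G i j * (\<Sum>k<p. matinv p ?G j k * c k))"
      by (simp add: ols_def c_def)
    also have "\<dots> = (\<Sum>k<p. (\<Sum>j<p. ?G i j * matinv p ?G j k) * c k)"
      by (simp add: sum_distrib_left sum_distrib_right mult.assoc) (rule sum.swap)
    also have "\<dots> = (\<Sum>k<p. (if i = k then 1 else 0) * c k)"
      using inv i by (intro sum.cong) (auto simp: mat_is_inv_def)
    also have "\<dots> = c i"
      using i by (simp add: sum.delta' if_distrib[where f="\<lambda>c. c * _"] cong: if_cong)
    finally show ?thesis
      by (simp add: b_def c right_diff_distrib sum_subtractf)
  qed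
  define S where "S = (\<Sum>i<p. (b i)\<^sup>2)"
  have S: "S \<ge> 0" by (simp add: S_def sum_nonneg)
  have "a * real T * S \<le> (\<Sum>i<p. b i * w i)"
    using ge[of b] by (simp add: qform_eq_sum_mult Gb S_def)
  then have "(a * real T * S)\<^sup>2 \<le> (\<Sum>i<p. b i * w i)\<^sup>2"
    using a S by (intro power_mono) auto
  also have "\<dots> \<le> S * (\<Sum>i<p. (w i)\<^sup>2)"
    unfolding S_def by (rule Cauchy_Schwarz_ineq_sum)
  finally have "S * ((a * real T)\<^sup>2 * S) \<le> S * (\<Sum>i<p. (w i)\<^sup>2)"
    by (simp add: power2_eq_square algebra_simps)
  \<comment> \<open>Cancelling S requires S to be nonzero; for S = 0 the claim is immediate.\<close>
  then have "S = 0 \<or> (a * real T)\<^sup>2 * S \<le> (\<Sum>i<p. (w i)\<^sup>2)"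
    using S by (auto simp: mult_le_cancel_left)
  then have "S \<le> (\<Sum>i<p. (w i)\<^sup>2) / (a * real T)\<^sup>2"
    using a T by (auto simp: pos_le_divide_eq mult.commute intro!: divide_nonneg_nonneg sum_nonneg)
  then show ?thesis
    by (simp add: S_def b_def w_def)
qed

section \<open>Second moments of series and sums\<close>

text \<open>Splitting each weight as \<open>sqrt w * sqrt w\<close>, Cauchy-Schwarz bounds the
  squared weighted sum by \<open>W\<close> times the sum of \<open>w j * (G j)^2\<close>, whose
  expectation is at most \<open>W * K\<close>. The terms may be dependent in any way.\<close>

lemma weighted_series_L2:
  fixes G :: "nat \<Rightarrow> 'a \<Rightarrow> real" and w :: "nat \<Rightarrow> real"
  assumes meas [measurable]: "\<And>j. G j \<in> borel_measurable M"
    and int: "\<And>j. integrable M (\<lambda>\<omega>. (G j \<omega>)\<^sup>2)"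
    and K: "\<And>j. (\<integral>\<omega>. (G j \<omega>)\<^sup>2 \<partial>M) \<le> K"
    and w: "\<And>j. 0 \<le> w j" "summable w"
  shows "AE \<omega> in M. summable (\<lambda>j. w j * \<bar>G j \<omega>\<bar>)"
    and "\<And>Y. Y \<in> borel_measurable M \<Longrightarrow> AE \<omega> in M. \<bar>Y \<omega>\<bar> \<le> (\<Sum>j. w j * \<bar>G j \<omega>\<bar>) \<Longrightarrow>
      integrable M (\<lambda>\<omega>. (Y \<omega>)\<^sup>2) \<and> (\<integral>\<omega>. (Y \<omega>)\<^sup>2 \<partial>M) \<le> K * (suminf w)\<^sup>2"
proof -
  have K0: "K \<ge> 0"
    by (rule order.trans[OF Bochner_Integration.integral_nonneg K[of 0]]) simp
  define W where "W = suminf w"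
  have W0: "W \<ge> 0" unfolding W_def using w by (simp add: suminf_nonneg)
  \<comment> \<open>Taken in the extended nonnegative reals, the series can be integrated termwise
    before its convergence is known; the finite integral then yields convergence almost
    everywhere.\<close>
  define h where "h \<omega> = (\<Sum>j. ennreal (w j * (G j \<omega>)\<^sup>2))" for \<omega>
  have h_meas [measurable]: "h \<in> borel_measurable M"
    unfolding h_def by measurable
  have h_int: "(\<integral>\<^sup>+\<omega>. h \<omega> \<partial>M) \<le> ennreal (W * K)"
  proof -
    have "(\<integral>\<^sup>+\<omega>. h \<omega> \<partial>M) = (\<Sum>j. \<integral>\<^sup>+\<omega>. ennreal (w j * (G j \<omega>)\<^sup>2) \<partial>M)"
      unfolding h_def by (intro nn_integral_suminf) auto
    also have "\<dots> = (\<Sum>j. ennreal (w j * (\<integral>\<omega>. (G j \<omega>)\<^sup>2 \<partial>M)))"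
    proof (intro suminf_cong)
      fix j
      show "(\<integral>\<^sup>+\<omega>. ennreal (w j * (G j \<omega>)\<^sup>2) \<partial>M) = ennreal (w j * (\<integral>\<omega>. (G j \<omega>)\<^sup>2 \<partial>M))"
        using w(1)[of j] int[of j] by (subst nn_integral_eq_integral) auto
    qed
    also have "\<dots> \<le> (\<Sum>j. ennreal (w j * K))"
      using w K by (intro suminf_le) (auto intro!: ennreal_leI mult_left_mono)
    also have "\<dots> = ennreal (W * K)"
      using w K0 by (subst suminf_ennreal2) (auto simp: W_def summable_mult2 suminf_mult2[symmetric])
    finally show ?thesis .
  qed
  have "AE \<omega> in M. h \<omega> \<noteq> \<infinity>"
    using h_int by (intro nn_integral_noteq_infinite) (auto simp: top_unique)
  then have sumsq: "AE \<omega> in M. summable (\<lambda>j. w j * (G j \<omega>)\<^sup>2)"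
  proof eventually_elim
    case (elim \<omega>)
    then show ?case
      unfolding h_def using w by (intro summable_suminf_not_top) auto
  qed
  \<comment> \<open>By \<open>\<bar>g\<bar> \<le> 1 + g^2\<close>, summability of the weights and of
    the weighted squares gives absolute summability.\<close>
  have le: "w j * \<bar>g\<bar> \<le> w j + w j * g\<^sup>2" for j and g :: real
  proof -
    have "\<bar>g\<bar> \<le> 1 + g\<^sup>2"
      using sum_squares_bound[of "\<bar>g\<bar>" 1] by (simp add: power2_eq_square)
    then have "w j * \<bar>g\<bar> \<le> w j * (1 + g\<^sup>2)"
      using w by (intro mult_left_mono)
    then show ?thesis by (simp add: algebra_simps)
  qed
  show sum1: "AE \<omega> in M. summable (\<lambda>j. w j * \<bar>G j \<omega>\<bar>)"
    using sumsq
  proof eventually_elim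
    case (elim \<omega>)
    show ?case
      by (rule summable_comparison_test'[OF summable_add[OF w(2) elim], of 0])
         (use w le in auto)
  qed
  fix Y assume Y [measurable]: "Y \<in> borel_measurable M"
    and Yle: "AE \<omega> in M. \<bar>Y \<omega>\<bar> \<le> (\<Sum>j. w j * \<bar>G j \<omega>\<bar>)"
  have "AE \<omega> in M. ennreal ((Y \<omega>)\<^sup>2) \<le> ennreal W * h \<omega>"
    using sumsq sum1 Yle
  proof eventually_elim
    case (elim \<omega>)
    have fin: "(\<Sum>j<n. w j * \<bar>G j \<omega>\<bar>)\<^sup>2 \<le> W * (\<Sum>j. w j * (G j \<omega>)\<^sup>2)" for n
    proof -
      have "(\<Sum>j<n. w j * \<bar>G j \<omega>\<bar>)\<^sup>2 = (\<Sum>j<n. sqrt (w j) * (sqrt (w j) * \<bar>G j \<omega>\<bar>))\<^sup>2"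
        using w by (simp add: mult.assoc[symmetric])
      also have "\<dots> \<le> (\<Sum>j<n. (sqrt (w j))\<^sup>2) * (\<Sum>j<n. (sqrt (w j) * \<bar>G j \<omega>\<bar>)\<^sup>2)"
        by (rule Cauchy_Schwarz_ineq_sum)
      also have "\<dots> = (\<Sum>j<n. w j) * (\<Sum>j<n. w j * (G j \<omega>)\<^sup>2)"
        using w by (simp add: power_mult_distrib)
      also have "\<dots> \<le> W * (\<Sum>j. w j * (G j \<omega>)\<^sup>2)"
        unfolding W_def using w elim(1)
        by (intro mult_mono sum_le_suminf suminf_nonneg) (auto intro!: sum_nonneg)
      finally show ?thesis .
    qed
    have "(\<Sum>j. w j * \<bar>G j \<omega>\<bar>)\<^sup>2 \<le> W * (\<Sum>j. w j * (G j \<omega>)\<^sup>2)"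
      by (rule LIMSEQ_le_const2[OF tendsto_power[OF summable_LIMSEQ[OF elim(2)]]]) (use fin in auto)
    moreover have "(Y \<omega>)\<^sup>2 \<le> (\<Sum>j. w j * \<bar>G j \<omega>\<bar>)\<^sup>2"
      using elim(3) power_mono[OF elim(3), of 2] by simp
    ultimately have "(Y \<omega>)\<^sup>2 \<le> W * (\<Sum>j. w j * (G j \<omega>)\<^sup>2)" by simp
    moreover have "h \<omega> = ennreal (\<Sum>j. w j * (G j \<omega>)\<^sup>2)"
      unfolding h_def using w elim(1) by (intro suminf_ennreal2) auto
    ultimately show ?case
      using W0 by (simp add: ennreal_mult'[symmetric] ennreal_leI)
  qed
  then have "(\<integral>\<^sup>+\<omega>. ennreal ((Y \<omega>)\<^sup>2) \<partial>M) \<le> (\<integral>\<^sup>+\<omega>. ennreal W * h \<omega> \<partial>M)"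
    by (rule nn_integral_mono_AE)
  also have "\<dots> = ennreal W * (\<integral>\<^sup>+\<omega>. h \<omega> \<partial>M)"
    by (rule nn_integral_cmult) simp
  also have "\<dots> \<le> ennreal W * ennreal (W * K)"
    by (intro mult_left_mono h_int) auto
  also have "\<dots> = ennreal (K * W\<^sup>2)"
    using W0 by (simp add: ennreal_mult'[symmetric] power2_eq_square mult_ac)
  finally have *: "(\<integral>\<^sup>+\<omega>. ennreal ((Y \<omega>)\<^sup>2) \<partial>M) \<le> ennreal (K * W\<^sup>2)" .
  have integrable: "integrable M (\<lambda>\<omega>. (Y \<omega>)\<^sup>2)"
    by (rule integrableI_nonneg) (use * in \<open>auto simp: less_top[symmetric] top_unique\<close>)
  with * have "(\<integral>\<omega>. (Y \<omega>)\<^sup>2 \<partial>M) \<le> K * W\<^sup>2"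
    using K0 by (subst (asm) nn_integral_eq_integral) (auto simp: ennreal_le_iff)
  with integrable show "integrable M (\<lambda>\<omega>. (Y \<omega>)\<^sup>2) \<and> (\<integral>\<omega>. (Y \<omega>)\<^sup>2 \<partial>M) \<le> K * (suminf w)\<^sup>2"
    by (simp add: W_def)
qed

lemma integrable_square_sum:
  fixes f :: "'i \<Rightarrow> 'a \<Rightarrow> real"
  assumes [measurable]: "\<And>i. i \<in> I \<Longrightarrow> f i \<in> borel_measurable M"
    and int: "\<And>i. i \<in> I \<Longrightarrow> integrable M (\<lambda>\<omega>. (f i \<omega>)\<^sup>2)"
  shows "integrable M (\<lambda>\<omega>. (\<Sum>i\<in>I. f i \<omega>)\<^sup>2)"
    and "(\<integral>\<omega>. (\<Sum>i\<in>I. f i \<omega>)\<^sup>2 \<partial>M) \<le> real (card I) * (\<Sum>i\<in>I. \<integral>\<omega>. (f i \<omega>)\<^sup>2 \<partial>M)"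
proof -
  have le: "(\<Sum>i\<in>I. f i \<omega>)\<^sup>2 \<le> real (card I) * (\<Sum>i\<in>I. (f i \<omega>)\<^sup>2)" for \<omega>
    using sum_squared_le_sum_of_squares[of "\<lambda>i. f i \<omega>" I] by (simp add: mult.commute)
  have int': "integrable M (\<lambda>\<omega>. real (card I) * (\<Sum>i\<in>I. (f i \<omega>)\<^sup>2))"
    using int by (intro integrable_mult_right Bochner_Integration.integrable_sum) auto
  show *: "integrable M (\<lambda>\<omega>. (\<Sum>i\<in>I. f i \<omega>)\<^sup>2)"
    by (rule Bochner_Integration.integrable_bound[OF int'])
       (use le in \<open>auto intro!: borel_measurable_power borel_measurable_sum simp: sum_nonneg\<close>)
  have "(\<integral>\<omega>. (\<Sum>i\<in>I. f i \<omega>)\<^sup>2 \<partial>M) \<le> (\<integral>\<omega>. real (card I) * (\<Sum>i\<in>I. (f i \<omega>)\<^sup>2) \<partial>M)"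
    by (intro integral_mono * int' le)
  also have "\<dots> = real (card I) * (\<Sum>i\<in>I. \<integral>\<omega>. (f i \<omega>)\<^sup>2 \<partial>M)"
    using int by (simp add: Bochner_Integration.integral_sum)
  finally show "(\<integral>\<omega>. (\<Sum>i\<in>I. f i \<omega>)\<^sup>2 \<partial>M) \<le> real (card I) * (\<Sum>i\<in>I. \<integral>\<omega>. (f i \<omega>)\<^sup>2 \<partial>M)" .
qed

lemma measurable_lin_proc:
  assumes "\<And>t k. k < d \<Longrightarrow> (\<lambda>\<omega>. e t \<omega> k) \<in> borel_measurable M"
  shows "(\<lambda>\<omega>. lin_proc d D e t \<omega> i) \<in> borel_measurable M"
  unfolding lin_proc_def using assms
  by (intro borel_measurable_suminf borel_measurable_sum borel_measurable_times) auto

text \<open>The j-th summand is dominated by \<open>w j\<close> times the sum of the d absolute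
  innovations at that lag. The square of that sum has expectation at most \<open>d^2 K\<close>, by
  Cauchy-Schwarz over the d coordinates.\<close>

lemma lin_proc_L2:
  fixes e :: "int \<Rightarrow> 'a \<Rightarrow> nat \<Rightarrow> real"
  assumes meas: "\<And>t k. k < d \<Longrightarrow> (\<lambda>\<omega>. e t \<omega> k) \<in> borel_measurable M"
    and int: "\<And>t k. k < d \<Longrightarrow> integrable M (\<lambda>\<omega>. (e t \<omega> k)\<^sup>2)"
    and K: "\<And>t k. k < d \<Longrightarrow> (\<integral>\<omega>. (e t \<omega> k)\<^sup>2 \<partial>M) \<le> K"
    and D: "\<And>j k. k < d \<Longrightarrow> \<bar>D j i k\<bar> \<le> w j" and w: "\<And>j. 0 \<le> w j" "summable w"
  shows "AE \<omega> in M. summable (\<lambda>j. \<Sum>k<d. D j i k * e (t - int j) \<omega> k)"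
    and "integrable M (\<lambda>\<omega>. (lin_proc d D e t \<omega> i)\<^sup>2)"
    and "(\<integral>\<omega>. (lin_proc d D e t \<omega> i)\<^sup>2 \<partial>M) \<le> (real d)\<^sup>2 * K * (suminf w)\<^sup>2"
proof -
  define G where "G j \<omega> = (\<Sum>k<d. \<bar>e (t - int j) \<omega> k\<bar>)" for j \<omega>
  have G_meas: "G j \<in> borel_measurable M" for j
    unfolding G_def using meas by (intro borel_measurable_sum borel_measurable_abs) auto
  have G_int: "integrable M (\<lambda>\<omega>. (G j \<omega>)\<^sup>2)" for j
    unfolding G_def using meas int by (intro integrable_square_sum) auto
  have G_K: "(\<integral>\<omega>. (G j \<omega>)\<^sup>2 \<partial>M) \<le> (real d)\<^sup>2 * K" for j
  proof -
    have "(\<integral>\<omega>. (G j \<omega>)\<^sup>2 \<partial>M) \<le> real (card {..<d}) * (\<Sum>k<d. \<integral>\<omega>. \<bar>e (t - int j) \<omega> k\<bar>\<^sup>2 \<partial>M)"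
      unfolding G_def using meas int by (intro integrable_square_sum) auto
    also have "\<dots> \<le> real d * (\<Sum>k<d. K)"
      using K by (intro mult_mono sum_mono sum_nonneg) auto
    finally show ?thesis by (simp add: power2_eq_square mult_ac)
  qed
  have term_le: "\<bar>\<Sum>k<d. D j i k * e (t - int j) \<omega> k\<bar> \<le> w j * \<bar>G j \<omega>\<bar>" for j \<omega>
  proof -
    have "\<bar>\<Sum>k<d. D j i k * e (t - int j) \<omega> k\<bar> \<le> (\<Sum>k<d. w j * \<bar>e (t - int j) \<omega> k\<bar>)"
      using D by (intro order.trans[OF sum_abs] sum_mono) (auto simp: abs_mult intro!: mult_right_mono)
    also have "\<dots> = w j * \<bar>G j \<omega>\<bar>"
      by (simp add: G_def sum_distrib_left sum_nonneg)
    finally show ?thesis .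
  qed
  note series = weighted_series_L2[of G M "(real d)\<^sup>2 * K" w, OF G_meas G_int G_K w]
  have abs_sum: "AE \<omega> in M. summable (\<lambda>j. \<bar>\<Sum>k<d. D j i k * e (t - int j) \<omega> k\<bar>)"
    using series(1)
  proof eventually_elim
    case (elim \<omega>)
    show ?case
      by (rule summable_comparison_test'[OF elim, of 0]) (use term_le in auto)
  qed
  then show "AE \<omega> in M. summable (\<lambda>j. \<Sum>k<d. D j i k * e (t - int j) \<omega> k)"
    by eventually_elim (rule summable_rabs_cancel)
  have "AE \<omega> in M. \<bar>lin_proc d D e t \<omega> i\<bar> \<le> (\<Sum>j. w j * \<bar>G j \<omega>\<bar>)"
    using series(1) abs_sum
  proof eventually_elim
    case (elim \<omega>)
    have "\<bar>lin_proc d D e t \<omega> i\<bar> \<le> (\<Sum>j. \<bar>\<Sum>k<d. D j i k * e (t - int j) \<omega> k\<bar>)"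
      unfolding lin_proc_def by (rule summable_rabs[OF elim(2)])
    also have "\<dots> \<le> (\<Sum>j. w j * \<bar>G j \<omega>\<bar>)"
      by (intro suminf_le elim term_le)
    finally show ?case .
  qed
  from series(2)[OF measurable_lin_proc[OF meas] this]
  show "integrable M (\<lambda>\<omega>. (lin_proc d D e t \<omega> i)\<^sup>2)"
    and "(\<integral>\<omega>. (lin_proc d D e t \<omega> i)\<^sup>2 \<partial>M) \<le> (real d)\<^sup>2 * K * (suminf w)\<^sup>2"
    by auto
qed

text \<open>Comparison with the telescoping series of \<open>1/N - 1/(N+1)\<close>. The case
  \<open>n = 0\<close> gives the weights of the full process, and positive n gives the tail left by
  truncation.\<close>

lemma inverse_square_tail:
  fixes n :: nat
  defines "w \<equiv> (\<lambda>j. if j < n then 0 else 1 / (real (Suc j))\<^sup>2)"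
  shows "summable w" and "suminf w \<le> 2" and "n \<ge> 1 \<Longrightarrow> suminf w \<le> 1 / real n"
proof -
  have w0: "w j \<ge> 0" for j by (simp add: w_def)
  have step: "w N \<le> 1 / real N - 1 / real (Suc N)" if "N \<ge> 1" for N
  proof -
    have "w N \<le> 1 / (real (Suc N))\<^sup>2" by (simp add: w_def)
    also have "\<dots> \<le> 1 / (real N * real (Suc N))"
      using that by (intro divide_left_mono) (auto simp: power2_eq_square)
    also have "\<dots> = 1 / real N - 1 / real (Suc N)"
      using that by (simp add: field_simps)
    finally show ?thesis .
  qed
  \<comment> \<open>The term at index 0 is at most 1, and the telescoping terms add less than
    1.\<close>
  have two: "sum w {..<Suc N} \<le> 2 - 1 / real (Suc N)" for N
  proof (induction N)
    case (Suc N)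
    then show ?case using step[of "Suc N"] by simp
  qed (simp add: w_def)
  have two': "sum w {..<N} \<le> 2" for N
  proof -
    have "sum w {..<N} \<le> sum w {..<Suc N}" using w0 by simp
    also note two[of N]
    also have "2 - 1 / real (Suc N) \<le> 2" by simp
    finally show ?thesis .
  qed
  show s: "summable w"
    by (rule summableI_nonneg_bounded[OF w0 two'])
  show "suminf w \<le> 2"
    by (rule suminf_le_const[OF s two'])
  show "suminf w \<le> 1 / real n" if n: "n \<ge> 1"
  proof (rule suminf_le_const[OF s])
    fix N
    have "sum w {..<n + N} \<le> 1 / real n - 1 / real (n + N)" for N
    proof (induction N)
      case (Suc N)
      then show ?case using step[of "n + N"] n by simp
    qed (simp add: w_def)
    from this[of N] have "sum w {..<n + N} \<le> 1 / real n"
      by (rule order.trans) simp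
    moreover have "sum w {..<N} \<le> sum w {..<n + N}"
      using w0 by (intro sum_mono2) auto
    ultimately show "sum w {..<N} \<le> 1 / real n" by simp
  qed
qed

text \<open>The mean minimises the mean square deviation. The free centre c matters because the
  Lipschitz bound controls a functional only relative to a fixed value.\<close>

lemma (in prob_space) variance_le_second_moment:
  fixes X :: "'a \<Rightarrow> real"
  assumes [measurable]: "X \<in> borel_measurable M" and int: "integrable M (\<lambda>\<omega>. (X \<omega> - c)\<^sup>2)"
  shows "integrable M X" and "integrable M (\<lambda>\<omega>. (X \<omega> - expectation X)\<^sup>2)"
    and "variance X \<le> expectation (\<lambda>\<omega>. (X \<omega> - c)\<^sup>2)"
proof -
  define X' where "X' \<omega> = X \<omega> - c" for \<omega>
  have [measurable]: "X' \<in> borel_measurable M" unfolding X'_def by measurable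
  have int': "integrable M (\<lambda>\<omega>. (X' \<omega>)\<^sup>2)" using int by (simp add: X'_def)
  then have X'_int: "integrable M X'" by (rule square_integrable_imp_integrable[rotated]) simp
  have X_eq: "X = (\<lambda>\<omega>. X' \<omega> + c)" by (simp add: X'_def)
  show X_int: "integrable M X" unfolding X_eq using X'_int by simp
  have c: "X \<omega> - expectation X = X' \<omega> - expectation X'" for \<omega>
    unfolding X_eq using X'_int by (simp add: prob_space)
  show "integrable M (\<lambda>\<omega>. (X \<omega> - expectation X)\<^sup>2)"
    unfolding c using X'_int int' by (simp add: power2_diff)
  have "variance X = variance X'" by (simp only: c)
  also have "\<dots> \<le> expectation (\<lambda>\<omega>. (X' \<omega>)\<^sup>2)"
    using variance_eq[OF X'_int int'] by simp
  finally show "variance X \<le> expectation (\<lambda>\<omega>. (X \<omega> - c)\<^sup>2)"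
    by (simp add: X'_def)
qed

section \<open>Sums with finite-range correlation\<close>

lemma integrable_mult_of_squares:
  fixes f g :: "'a \<Rightarrow> real"
  assumes [measurable]: "f \<in> borel_measurable M" "g \<in> borel_measurable M"
    and int: "integrable M (\<lambda>\<omega>. (f \<omega>)\<^sup>2)" "integrable M (\<lambda>\<omega>. (g \<omega>)\<^sup>2)"
  shows "integrable M (\<lambda>\<omega>. f \<omega> * g \<omega>)"
    and "2 * \<bar>\<integral>\<omega>. f \<omega> * g \<omega> \<partial>M\<bar> \<le> (\<integral>\<omega>. (f \<omega>)\<^sup>2 \<partial>M) + (\<integral>\<omega>. (g \<omega>)\<^sup>2 \<partial>M)"
proof -
  have le: "2 * \<bar>f \<omega> * g \<omega>\<bar> \<le> (f \<omega>)\<^sup>2 + (g \<omega>)\<^sup>2" for \<omega>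
    using sum_squares_bound[of "\<bar>f \<omega>\<bar>" "\<bar>g \<omega>\<bar>"] by (simp add: abs_mult)
  have le': "\<bar>f \<omega> * g \<omega>\<bar> \<le> (f \<omega>)\<^sup>2 + (g \<omega>)\<^sup>2" for \<omega>
    using le[of \<omega>] abs_ge_zero[of "f \<omega> * g \<omega>"] by linarith
  show *: "integrable M (\<lambda>\<omega>. f \<omega> * g \<omega>)"
    by (rule Bochner_Integration.integrable_bound[OF Bochner_Integration.integrable_add[OF int]])
       (use le' in auto)
  have "2 * \<bar>\<integral>\<omega>. f \<omega> * g \<omega> \<partial>M\<bar> \<le> 2 * (\<integral>\<omega>. \<bar>f \<omega> * g \<omega>\<bar> \<partial>M)"
    using integral_abs_bound[of M "\<lambda>\<omega>. f \<omega> * g \<omega>"] by simp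
  also have "\<dots> = (\<integral>\<omega>. 2 * \<bar>f \<omega> * g \<omega>\<bar> \<partial>M)" by simp
  also have "\<dots> \<le> (\<integral>\<omega>. (f \<omega>)\<^sup>2 + (g \<omega>)\<^sup>2 \<partial>M)"
    using * int le by (intro integral_mono) auto
  finally show "2 * \<bar>\<integral>\<omega>. f \<omega> * g \<omega> \<partial>M\<bar> \<le> (\<integral>\<omega>. (f \<omega>)\<^sup>2 \<partial>M) + (\<integral>\<omega>. (g \<omega>)\<^sup>2 \<partial>M)"
    using int by simp
qed

text \<open>Expanding the square leaves T^2 covariances. Those at distance h or more vanish, each of
  the others contributes at most \<open>B^2 * V\<close>, and every s has at most 2h + 1 partners
  t.\<close>

lemma second_moment_sum_of_locally_correlated:
  fixes Z :: "nat \<Rightarrow> 'a \<Rightarrow> real" and h T :: nat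
  assumes meas: "\<And>t. Z t \<in> borel_measurable M"
    and int: "\<And>t. integrable M (\<lambda>\<omega>. (Z t \<omega>)\<^sup>2)"
    and V: "\<And>t. (\<integral>\<omega>. (Z t \<omega>)\<^sup>2 \<partial>M) \<le> V"
    and orth: "\<And>s t. s + h \<le> t \<Longrightarrow> (\<integral>\<omega>. Z s \<omega> * Z t \<omega> \<partial>M) = 0"
    and a: "\<And>t. t \<in> {1..T} \<Longrightarrow> \<bar>a t\<bar> \<le> B"
  shows "(\<integral>\<omega>. (\<Sum>t=1..T. a t * Z t \<omega>)\<^sup>2 \<partial>M) \<le> B\<^sup>2 * V * real T * (2 * real h + 1)"
proof -
  note prod = integrable_mult_of_squares[OF meas meas int int]
  have V0: "V \<ge> 0"
    by (rule order.trans[OF Bochner_Integration.integral_nonneg V[of 0]]) simp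
  have "(\<integral>\<omega>. (\<Sum>t=1..T. a t * Z t \<omega>)\<^sup>2 \<partial>M)
      = (\<integral>\<omega>. (\<Sum>s=1..T. \<Sum>t=1..T. a s * a t * (Z s \<omega> * Z t \<omega>)) \<partial>M)"
    by (simp add: power2_eq_square sum_product mult_ac)
  also have "\<dots> = (\<Sum>s=1..T. \<Sum>t=1..T. a s * a t * (\<integral>\<omega>. Z s \<omega> * Z t \<omega> \<partial>M))"
    using prod(1) by (simp add: Bochner_Integration.integral_sum)
  \<comment> \<open>Subtraction on naturals cuts the window \<open>s - h\<close> off at 0, which
    loses no index; including distance exactly h only enlarges the bound.\<close>
  also have "\<dots> \<le> (\<Sum>s=1..T. \<Sum>t=1..T. if t \<in> {s-h..s+h} then B\<^sup>2 * V else 0)"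
  proof (intro sum_mono)
    fix s t assume s: "s \<in> {1..T}" and t: "t \<in> {1..T}"
    have near: "a s * a t * (\<integral>\<omega>. Z s \<omega> * Z t \<omega> \<partial>M) \<le> B\<^sup>2 * V"
    proof -
      have "\<bar>\<integral>\<omega>. Z s \<omega> * Z t \<omega> \<partial>M\<bar> \<le> V"
        using prod(2)[of s t] V[of s] V[of t] by simp
      then have "\<bar>a s\<bar> * \<bar>a t\<bar> * \<bar>\<integral>\<omega>. Z s \<omega> * Z t \<omega> \<partial>M\<bar> \<le> B * B * V"
        using a[OF s] a[OF t] V0 by (intro mult_mono) auto
      then show ?thesis
        by (simp add: power2_eq_square abs_mult[symmetric] abs_le_iff)
    qed
    have far: "(\<integral>\<omega>. Z s \<omega> * Z t \<omega> \<partial>M) = 0" if "t \<notin> {s-h..s+h}"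
    proof -
      from that consider "s + h \<le> t" | "t + h \<le> s" by force
      then show ?thesis
        by cases (use orth[of s t] orth[of t s] in \<open>auto simp: mult.commute\<close>)
    qed
    show "a s * a t * (\<integral>\<omega>. Z s \<omega> * Z t \<omega> \<partial>M) \<le> (if t \<in> {s-h..s+h} then B\<^sup>2 * V else 0)"
      using near far by auto
  qed
  also have "\<dots> \<le> (\<Sum>s=1..T. (2 * real h + 1) * (B\<^sup>2 * V))"
  proof (intro sum_mono)
    fix s
    have eq: "(\<Sum>t=1..T. if t \<in> {s-h..s+h} then B\<^sup>2 * V else 0)
        = real (card ({1..T} \<inter> {s-h..s+h})) * (B\<^sup>2 * V)"
      by (subst sum.inter_restrict[symmetric]) auto
    have "card ({1..T} \<inter> {s-h..s+h}) \<le> card {s-h..s+h}"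
      by (intro card_mono) auto
    also have "card {s-h..s+h} \<le> 2 * h + 1"
      unfolding card_atLeastAtMost by arith
    finally have "card ({1..T} \<inter> {s-h..s+h}) \<le> 2 * h + 1" .
    then have "real (card ({1..T} \<inter> {s-h..s+h})) \<le> 2 * real h + 1" by linarith
    then have "real (card ({1..T} \<inter> {s-h..s+h})) * (B\<^sup>2 * V) \<le> (2 * real h + 1) * (B\<^sup>2 * V)"
      using V0 by (intro mult_right_mono) auto
    with eq show "(\<Sum>t=1..T. if t \<in> {s-h..s+h} then B\<^sup>2 * V else 0) \<le> (2 * real h + 1) * (B\<^sup>2 * V)"
      by simp
  qed
  finally show ?thesis by (simp add: mult_ac)
qed

section \<open>Lipschitz functionals of spatial linear processes\<close>

text \<open>One coordinate h of the nonlinear map is fixed. The spatial factors and the local noise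
  form a single family indexed by l, with coefficients \<open>coef t i l\<close> that absorb the
  locations, and the decay of the matrices enters as a multiple of \<open>1/(j+1)^2\<close>.\<close>

locale spatial_linear_field = prob_space M for M :: "'a measure" +
  fixes d L m :: nat
    and eps :: "nat \<Rightarrow> int \<Rightarrow> 'a \<Rightarrow> nat \<Rightarrow> real"
    and C :: "nat \<Rightarrow> nat \<Rightarrow> nat \<Rightarrow> nat \<Rightarrow> real"
    and coef :: "nat \<Rightarrow> nat \<Rightarrow> nat \<Rightarrow> real"
    and h :: "(nat \<Rightarrow> nat \<Rightarrow> real) \<Rightarrow> real"
    and K Cc Bc LH :: real
  assumes eps_indep: "indep_vars (\<lambda>_. Pi\<^sub>M {..<d} (\<lambda>_. borel))
        (\<lambda>(l, t) \<omega>. restrict (eps l t \<omega>) {..<d}) ({..L} \<times> UNIV)"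
    and eps_meas: "\<And>l t k. l \<le> L \<Longrightarrow> k < d \<Longrightarrow> (\<lambda>\<omega>. eps l t \<omega> k) \<in> borel_measurable M"
    and eps_int: "\<And>l t k. l \<le> L \<Longrightarrow> k < d \<Longrightarrow> integrable M (\<lambda>\<omega>. (eps l t \<omega> k)\<^sup>2)"
    and eps_K: "\<And>l t k. l \<le> L \<Longrightarrow> k < d \<Longrightarrow> expectation (\<lambda>\<omega>. (eps l t \<omega> k)\<^sup>2) \<le> K"
    and C_bound: "\<And>l j i k. l \<le> L \<Longrightarrow> i < d \<Longrightarrow> k < d \<Longrightarrow> \<bar>C l j i k\<bar> \<le> Cc * (1 / (real (Suc j))\<^sup>2)"
    and coef_bound: "\<And>t l i. l \<le> L \<Longrightarrow> i < d \<Longrightarrow> \<bar>coef t i l\<bar> \<le> Bc"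
    and nonneg: "0 \<le> K" "0 \<le> Cc" "0 \<le> LH"
    and lipschitz: "\<And>A B. \<bar>h A - h B\<bar> \<le> LH * sqrt (\<Sum>i<d. \<Sum>k\<le>m. (A i k - B i k)\<^sup>2)"
begin

text \<open>The coefficient array D is a parameter, so that the full, truncated, difference and zero
  processes are instances of one object. Here i is the coordinate and k the lag in the window of
  h.\<close>

definition field :: "(nat \<Rightarrow> nat \<Rightarrow> nat \<Rightarrow> nat \<Rightarrow> real) \<Rightarrow> nat \<Rightarrow> 'a \<Rightarrow> nat \<Rightarrow> nat \<Rightarrow> real" where
  "field D t \<omega> i k = (\<Sum>l\<le>L. coef t i l * lin_proc d (D l) (eps l) (int t - int k) \<omega> i)"

definition trunc :: "nat \<Rightarrow> nat \<Rightarrow> nat \<Rightarrow> nat \<Rightarrow> nat \<Rightarrow> real" where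
  "trunc n l j i k = (if j < n then C l j i k else 0)"

lemma h_cong:
  assumes "\<And>i k. i < d \<Longrightarrow> k \<le> m \<Longrightarrow> A i k = B i k"
  shows "h A = h B"
  using lipschitz[of A B] assms by simp

text \<open>The Lipschitz bound involves finitely many entries, each a continuous coordinate of the
  product topology, so it tends to 0 at every point.\<close>

lemma continuous_on_h: "continuous_on UNIV h"
proof (intro continuous_at_imp_continuous_on ballI)
  fix A0 :: "nat \<Rightarrow> nat \<Rightarrow> real"
  define g where "g A = LH * sqrt (\<Sum>i<d. \<Sum>k\<le>m. (A i k - A0 i k)\<^sup>2)" for A :: "nat \<Rightarrow> nat \<Rightarrow> real"
  have "continuous_on UNIV (\<lambda>A::nat \<Rightarrow> nat \<Rightarrow> real. A i k)" for i k
    by (rule continuous_on_product_then_coordinatewise) simp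
  then have "continuous_on UNIV g"
    unfolding g_def by (intro continuous_intros)
  then have "(g \<longlongrightarrow> g A0) (at A0)"
    by (simp add: continuous_on_def)
  then have "(g \<longlongrightarrow> 0) (at A0)"
    by (simp add: g_def)
  then have "((\<lambda>A. h A - h A0) \<longlongrightarrow> 0) (at A0)"
    by (rule Lim_null_comparison[rotated]) (use lipschitz in \<open>auto simp: g_def\<close>)
  then show "isCont h A0"
    by (simp add: isCont_def LIM_zero_iff)
qed

lemma measurable_h:
  assumes "\<And>i k. i < d \<Longrightarrow> k \<le> m \<Longrightarrow> (\<lambda>\<omega>. F \<omega> i k) \<in> borel_measurable N"
  shows "(\<lambda>\<omega>. h (F \<omega>)) \<in> borel_measurable N"
proof -
  \<comment> \<open>Nothing is assumed about entries outside the d by (m+1) block; setting them to 0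
    makes the whole array measurable without changing the value of h.\<close>
  define F' where "F' \<omega> i k = (if i < d \<and> k \<le> m then F \<omega> i k else 0)" for \<omega> i k
  have "(\<lambda>\<omega>. F' \<omega> i k) \<in> borel_measurable N" for i k
    using assms[of i k] by (cases "i < d \<and> k \<le> m") (auto simp: F'_def)
  then have "F' \<in> borel_measurable N"
    by (intro measurable_coordinatewise_then_product)
  then have "(\<lambda>\<omega>. h (F' \<omega>)) \<in> borel_measurable N"
    by (rule borel_measurable_continuous_on[OF continuous_on_h])
  moreover have "h (F' \<omega>) = h (F \<omega>)" for \<omega>
    by (rule h_cong) (simp add: F'_def)
  ultimately show ?thesis by simp
qed

lemma measurable_field: "i < d \<Longrightarrow> (\<lambda>\<omega>. field D t \<omega> i k) \<in> borel_measurable M"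
  unfolding field_def using eps_meas
  by (intro borel_measurable_sum borel_measurable_times measurable_lin_proc) auto

lemma measurable_h_field: "(\<lambda>\<omega>. h (field D t \<omega>)) \<in> borel_measurable M"
  by (intro measurable_h measurable_field)

text \<open>Cauchy-Schwarz over the L + 1 components gives \<open>(L+1)^2\<close>, the coefficients
  give \<open>Bc^2\<close>, and \<open>d^2 K\<close> comes from \<open>lin_proc_L2\<close>.\<close>

definition K1 :: real where
  "K1 = (real (Suc L))\<^sup>2 * Bc\<^sup>2 * ((real d)\<^sup>2 * K)"

lemma field_L2:
  assumes D: "\<And>l j k. l \<le> L \<Longrightarrow> k < d \<Longrightarrow> \<bar>D l j i k\<bar> \<le> w j"
    and w: "\<And>j. 0 \<le> w j" "summable w" and i: "i < d"
  shows "integrable M (\<lambda>\<omega>. (field D t \<omega> i k)\<^sup>2)"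
    and "expectation (\<lambda>\<omega>. (field D t \<omega> i k)\<^sup>2) \<le> K1 * (suminf w)\<^sup>2"
proof -
  define f where "f l \<omega> = coef t i l * lin_proc d (D l) (eps l) (int t - int k) \<omega> i" for l \<omega>
  have f_meas: "f l \<in> borel_measurable M" if "l \<le> L" for l
    unfolding f_def using eps_meas that by (intro borel_measurable_times measurable_lin_proc) auto
  have L2: "integrable M (\<lambda>\<omega>. (lin_proc d (D l) (eps l) (int t - int k) \<omega> i)\<^sup>2)"
    "expectation (\<lambda>\<omega>. (lin_proc d (D l) (eps l) (int t - int k) \<omega> i)\<^sup>2) \<le> (real d)\<^sup>2 * K * (suminf w)\<^sup>2"
    if "l \<le> L" for l
    by (rule lin_proc_L2[where K = K and w = w]; use that eps_meas eps_int eps_K D w in auto)+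
  have f_int: "integrable M (\<lambda>\<omega>. (f l \<omega>)\<^sup>2)" if "l \<le> L" for l
    using L2(1)[OF that] by (simp add: f_def power_mult_distrib)
  have f_K: "expectation (\<lambda>\<omega>. (f l \<omega>)\<^sup>2) \<le> Bc\<^sup>2 * ((real d)\<^sup>2 * K * (suminf w)\<^sup>2)" if "l \<le> L" for l
  proof -
    have "(coef t i l)\<^sup>2 \<le> Bc\<^sup>2"
      using power_mono[OF coef_bound[OF that i, of t], of 2] by simp
    then show ?thesis
      using L2(2)[OF that] by (auto simp: f_def power_mult_distrib intro!: mult_mono)
  qed
  have eq: "field D t \<omega> i k = (\<Sum>l\<le>L. f l \<omega>)" for \<omega>
    by (simp add: field_def f_def)
  show "integrable M (\<lambda>\<omega>. (field D t \<omega> i k)\<^sup>2)"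
    unfolding eq using f_meas f_int by (intro integrable_square_sum) auto
  have "expectation (\<lambda>\<omega>. (field D t \<omega> i k)\<^sup>2) \<le> real (card {..L}) * (\<Sum>l\<le>L. expectation (\<lambda>\<omega>. (f l \<omega>)\<^sup>2))"
    unfolding eq using f_meas f_int by (intro integrable_square_sum) auto
  also have "\<dots> \<le> real (card {..L}) * (\<Sum>l\<le>L. Bc\<^sup>2 * ((real d)\<^sup>2 * K * (suminf w)\<^sup>2))"
    using f_K by (intro mult_left_mono sum_mono) auto
  also have "\<dots> = K1 * (suminf w)\<^sup>2"
    by (simp add: K1_def power2_eq_square mult_ac)
  finally show "expectation (\<lambda>\<omega>. (field D t \<omega> i k)\<^sup>2) \<le> K1 * (suminf w)\<^sup>2" .
qed

text \<open>Subtracting two \<open>suminf\<close> terms is legitimate only where both series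
  converge; the common dominating weights v provide this almost everywhere.\<close>

lemma field_diff:
  assumes D: "\<And>l j k. l \<le> L \<Longrightarrow> k < d \<Longrightarrow> \<bar>D l j i k\<bar> \<le> v j"
    and D': "\<And>l j k. l \<le> L \<Longrightarrow> k < d \<Longrightarrow> \<bar>D' l j i k\<bar> \<le> v j"
    and v: "\<And>j. 0 \<le> v j" "summable v"
  shows "AE \<omega> in M. field D t \<omega> i k - field D' t \<omega> i k = field (\<lambda>l j i k. D l j i k - D' l j i k) t \<omega> i k"
proof -
  let ?s = "\<lambda>D l \<omega>. summable (\<lambda>j. \<Sum>k'<d. D l j i k' * eps l (int t - int k - int j) \<omega> k')"
  have ae: "AE \<omega> in M. \<forall>l\<in>{..L}. ?s E l \<omega>"
    if E: "\<And>l j k. l \<le> L \<Longrightarrow> k < d \<Longrightarrow> \<bar>E l j i k\<bar> \<le> v j" for E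
  proof (rule AE_finite_allI)
    fix l assume l: "l \<in> {..L}"
    show "AE \<omega> in M. ?s E l \<omega>"
      using l eps_meas eps_int eps_K E v by (intro lin_proc_L2(1)[where K = K]) auto
  qed simp
  have "AE \<omega> in M. \<forall>l\<in>{..L}. ?s D l \<omega>" "AE \<omega> in M. \<forall>l\<in>{..L}. ?s D' l \<omega>"
    by (intro ae D D'; assumption)+
  then show ?thesis
  proof eventually_elim
    case (elim \<omega>)
    show ?case
      unfolding field_def sum_subtractf[symmetric] right_diff_distrib[symmetric]
    proof (intro sum.cong refl arg_cong2[where f = "(*)"])
      fix l assume "l \<in> {..L}"
      with elim have s: "?s D l \<omega>" "?s D' l \<omega>" by auto
      show "lin_proc d (D l) (eps l) (int t - int k) \<omega> i - lin_proc d (D' l) (eps l) (int t - int k) \<omega> i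
        = lin_proc d (\<lambda>j i k. D l j i k - D' l j i k) (eps l) (int t - int k) \<omega> i"
        unfolding lin_proc_def suminf_diff[OF s] by (simp add: left_diff_distrib sum_subtractf)
    qed
  qed
qed

text \<open>By the Lipschitz property, the difference is controlled by the field with the
  coefficients \<open>D - D'\<close>. The weights v secure convergence of both fields, while w
  measures their distance and alone enters the bound.\<close>

lemma h_field_diff_L2:
  assumes D: "\<And>l j i k. l \<le> L \<Longrightarrow> i < d \<Longrightarrow> k < d \<Longrightarrow> \<bar>D l j i k\<bar> \<le> v j"
    and D': "\<And>l j i k. l \<le> L \<Longrightarrow> i < d \<Longrightarrow> k < d \<Longrightarrow> \<bar>D' l j i k\<bar> \<le> v j"
    and DD': "\<And>l j i k. l \<le> L \<Longrightarrow> i < d \<Longrightarrow> k < d \<Longrightarrow> \<bar>D l j i k - D' l j i k\<bar> \<le> w j"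
    and v: "\<And>j. 0 \<le> v j" "summable v" and w: "\<And>j. 0 \<le> w j" "summable w"
  shows "integrable M (\<lambda>\<omega>. (h (field D t \<omega>) - h (field D' t \<omega>))\<^sup>2)"
    and "expectation (\<lambda>\<omega>. (h (field D t \<omega>) - h (field D' t \<omega>))\<^sup>2)
      \<le> LH\<^sup>2 * (real d * real (Suc m) * K1) * (suminf w)\<^sup>2"
proof -
  let ?E = "\<lambda>l j i k. D l j i k - D' l j i k"
  let ?S = "\<lambda>\<omega>. LH\<^sup>2 * (\<Sum>i<d. \<Sum>k\<le>m. (field ?E t \<omega> i k)\<^sup>2)"
  have "AE \<omega> in M. \<forall>i\<in>{..<d}. \<forall>k\<in>{..m}. field D t \<omega> i k - field D' t \<omega> i k = field ?E t \<omega> i k"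
    using D D' v by (intro AE_finite_allI field_diff[where v = v]) auto
  then have le: "AE \<omega> in M. (h (field D t \<omega>) - h (field D' t \<omega>))\<^sup>2 \<le> ?S \<omega>"
  proof eventually_elim
    case (elim \<omega>)
    have "(\<Sum>i<d. \<Sum>k\<le>m. (field D t \<omega> i k - field D' t \<omega> i k)\<^sup>2)
        = (\<Sum>i<d. \<Sum>k\<le>m. (field ?E t \<omega> i k)\<^sup>2)"
      using elim by (intro sum.cong) auto
    with lipschitz[of "field D t \<omega>" "field D' t \<omega>"]
    have "\<bar>h (field D t \<omega>) - h (field D' t \<omega>)\<bar> \<le> LH * sqrt (\<Sum>i<d. \<Sum>k\<le>m. (field ?E t \<omega> i k)\<^sup>2)"
      by simp
    from power_mono[OF this, of 2] show ?case
      by (simp add: power_mult_distrib sum_nonneg)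
  qed
  note L2 = field_L2[of ?E _ w, OF DD' w]
  have int: "integrable M ?S"
    using L2(1) by (intro integrable_mult_right Bochner_Integration.integrable_sum) auto
  have meas: "(\<lambda>\<omega>. (h (field D t \<omega>) - h (field D' t \<omega>))\<^sup>2) \<in> borel_measurable M"
    using measurable_h_field by (intro borel_measurable_power borel_measurable_diff)
  show *: "integrable M (\<lambda>\<omega>. (h (field D t \<omega>) - h (field D' t \<omega>))\<^sup>2)"
    by (rule Bochner_Integration.integrable_bound[OF int meas])
       (use le in \<open>auto simp: sum_nonneg\<close>)
  have "expectation (\<lambda>\<omega>. (h (field D t \<omega>) - h (field D' t \<omega>))\<^sup>2) \<le> expectation ?S"
    by (intro integral_mono_AE * int le)
  also have "\<dots> = LH\<^sup>2 * (\<Sum>i<d. \<Sum>k\<le>m. expectation (\<lambda>\<omega>. (field ?E t \<omega> i k)\<^sup>2))"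
    using L2(1) by (simp add: Bochner_Integration.integral_sum)
  also have "\<dots> \<le> LH\<^sup>2 * (\<Sum>i<d. \<Sum>k\<le>m. K1 * (suminf w)\<^sup>2)"
    using L2(2) by (intro mult_left_mono sum_mono) auto
  also have "\<dots> = LH\<^sup>2 * (real d * real (Suc m) * K1) * (suminf w)\<^sup>2"
    by simp
  finally show "expectation (\<lambda>\<omega>. (h (field D t \<omega>) - h (field D' t \<omega>))\<^sup>2)
      \<le> LH\<^sup>2 * (real d * real (Suc m) * K1) * (suminf w)\<^sup>2" .
qed

text \<open>Chosen so that coefficient differences bounded by \<open>Cc * w j\<close> give a mean
  square difference of at most \<open>Q * (suminf w)^2\<close>.\<close>

definition Q :: real where
  "Q = LH\<^sup>2 * (real d * real (Suc m) * K1) * Cc\<^sup>2"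

lemma Q_nonneg: "Q \<ge> 0"
  using nonneg by (simp add: Q_def K1_def)

lemma suminf_Cc_le:
  assumes "summable w" "\<And>j. 0 \<le> w j" "suminf w \<le> c"
  shows "LH\<^sup>2 * (real d * real (Suc m) * K1) * (\<Sum>j. Cc * w j)\<^sup>2 \<le> Q * c\<^sup>2"
proof -
  have "(suminf w)\<^sup>2 \<le> c\<^sup>2"
    using assms by (intro power_mono suminf_nonneg) auto
  then have "Q * (suminf w)\<^sup>2 \<le> Q * c\<^sup>2"
    using Q_nonneg by (rule mult_left_mono)
  then show ?thesis
    using assms by (simp add: suminf_mult power_mult_distrib Q_def mult_ac)
qed

section \<open>Truncation after n lags\<close>

lemma summable_Cc: "summable (\<lambda>j. Cc * (1 / (real (Suc j))\<^sup>2))"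
  using inverse_square_tail(1)[of 0] by (intro summable_mult) simp

lemma abs_trunc_le:
  "l \<le> L \<Longrightarrow> i < d \<Longrightarrow> k < d \<Longrightarrow> \<bar>trunc n l j i k\<bar> \<le> Cc * (1 / (real (Suc j))\<^sup>2)"
  using C_bound[of l i k j] nonneg by (simp add: trunc_def)

text \<open>The discarded coefficients are those at lags from n on, and their inverse-square weights
  sum to at most 1/n.\<close>

lemma truncation_error:
  assumes n: "n \<ge> 1"
  shows "integrable M (\<lambda>\<omega>. (h (field C t \<omega>) - h (field (trunc n) t \<omega>))\<^sup>2)"
    and "expectation (\<lambda>\<omega>. (h (field C t \<omega>) - h (field (trunc n) t \<omega>))\<^sup>2) \<le> Q / (real n)\<^sup>2"
proof -
  define w where "w j = (if j < n then 0 else 1 / (real (Suc j))\<^sup>2)" for j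
  have w: "\<And>j. 0 \<le> w j" "summable w" "suminf w \<le> 1 / real n"
    using inverse_square_tail(1,3)[of n] n by (auto simp: w_def[abs_def])
  have diff: "\<bar>C l j i k - trunc n l j i k\<bar> \<le> Cc * w j" if "l \<le> L" "i < d" "k < d" for l i j k
    using C_bound[OF that, of j] by (simp add: trunc_def w_def)
  note L2 = h_field_diff_L2[of C "\<lambda>j. Cc * (1 / (real (Suc j))\<^sup>2)" "trunc n" "\<lambda>j. Cc * w j",
      OF C_bound abs_trunc_le diff _ summable_Cc]
  show "integrable M (\<lambda>\<omega>. (h (field C t \<omega>) - h (field (trunc n) t \<omega>))\<^sup>2)"
    using w nonneg by (intro L2) (auto intro: summable_mult)
  have "expectation (\<lambda>\<omega>. (h (field C t \<omega>) - h (field (trunc n) t \<omega>))\<^sup>2)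
      \<le> LH\<^sup>2 * (real d * real (Suc m) * K1) * (\<Sum>j. Cc * w j)\<^sup>2"
    using w nonneg by (intro L2) (auto intro: summable_mult)
  also have "\<dots> \<le> Q * (1 / real n)\<^sup>2"
    using w by (intro suminf_Cc_le) auto
  finally show "expectation (\<lambda>\<omega>. (h (field C t \<omega>) - h (field (trunc n) t \<omega>))\<^sup>2) \<le> Q / (real n)\<^sup>2"
    by (simp add: power_divide)
qed

text \<open>Comparison with the zero coefficient array, whose field vanishes, so that h takes the
  constant value \<open>h (\<lambda>_ _. 0)\<close>. The factor 4 is the square of the bound 2 on
  the total weight, uniform in n.\<close>

lemma truncated_second_moment:
  shows "integrable M (\<lambda>\<omega>. (h (field (trunc n) t \<omega>) - h (\<lambda>_ _. 0))\<^sup>2)"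
    and "expectation (\<lambda>\<omega>. (h (field (trunc n) t \<omega>) - h (\<lambda>_ _. 0))\<^sup>2) \<le> 4 * Q"
proof -
  define w where "w j = 1 / (real (Suc j))\<^sup>2" for j
  have w: "\<And>j. 0 \<le> w j" "summable w" "suminf w \<le> 2"
    using inverse_square_tail(1,2)[of 0] by (auto simp: w_def[abs_def])
  have Cw: "\<And>j. 0 \<le> Cc * w j" "summable (\<lambda>j. Cc * w j)"
    using w nonneg by (auto intro: summable_mult)
  have zero: "field (\<lambda>_ _ _ _. 0) t = (\<lambda>_ _ _. 0)"
    by (intro ext) (simp add: field_def lin_proc_def)
  note L2 = h_field_diff_L2[of "trunc n" "\<lambda>j. Cc * w j" "\<lambda>_ _ _ _. 0" "\<lambda>j. Cc * w j" t,
      OF _ _ _ Cw Cw, unfolded zero]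
  show "integrable M (\<lambda>\<omega>. (h (field (trunc n) t \<omega>) - h (\<lambda>_ _. 0))\<^sup>2)"
    using abs_trunc_le Cw(1) by (intro L2) (auto simp: w_def)
  have "expectation (\<lambda>\<omega>. (h (field (trunc n) t \<omega>) - h (\<lambda>_ _. 0))\<^sup>2)
      \<le> LH\<^sup>2 * (real d * real (Suc m) * K1) * (\<Sum>j. Cc * w j)\<^sup>2"
    using abs_trunc_le Cw(1) by (intro L2) (auto simp: w_def)
  also have "\<dots> \<le> Q * 2\<^sup>2"
    using w by (intro suminf_Cc_le) auto
  finally show "expectation (\<lambda>\<omega>. (h (field (trunc n) t \<omega>) - h (\<lambda>_ _. 0))\<^sup>2) \<le> 4 * Q"
    by simp
qed

text \<open>The two values are measurable functions of the innovations in two disjoint blocks of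
  time.\<close>

lemma truncated_indep:
  assumes st: "s + (n + m) \<le> t"
  shows "indep_var borel (\<lambda>\<omega>. h (field (trunc n) s \<omega>)) borel (\<lambda>\<omega>. h (field (trunc n) t \<omega>))"
proof -
  define X where "X = (\<lambda>(l, t) \<omega>. restrict (eps l t \<omega>) {..<d})"
  \<comment> \<open>The oldest innovation has window lag m and series lag n - 1, hence time t - m -
    n + 1; the interval is therefore open on the left, and separation n + m suffices for
    disjointness.\<close>
  define A where "A t = {..L} \<times> {int t - int m - int n <..int t}" for t :: nat
  define f where "f t g = h (\<lambda>i k. \<Sum>l\<le>L. coef t i l *
      (\<Sum>j<n. \<Sum>k'<d. C l j i k' * g (l, int t - int k - int j) k'))"
    for t :: nat and g :: "nat \<times> int \<Rightarrow> nat \<Rightarrow> real"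
  have ind: "indep_var (PiM (A s) (\<lambda>_. Pi\<^sub>M {..<d} (\<lambda>_. borel))) (\<lambda>\<omega>. restrict (\<lambda>i. X i \<omega>) (A s))
      (PiM (A t) (\<lambda>_. Pi\<^sub>M {..<d} (\<lambda>_. borel))) (\<lambda>\<omega>. restrict (\<lambda>i. X i \<omega>) (A t))"
    by (rule indep_var_restrict[OF eps_indep[folded X_def]]) (use st in \<open>auto simp: A_def\<close>)
  have f_meas: "f t \<in> borel_measurable (PiM (A t) (\<lambda>_. Pi\<^sub>M {..<d} (\<lambda>_. borel)))" for t
    unfolding f_def
  proof (intro measurable_h borel_measurable_sum borel_measurable_times borel_measurable_const)
    fix i k l j k'
    assume *: "k \<le> m" "l \<in> {..L}" "j \<in> {..<n}" "k' \<in> {..<d}"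
    then have "(l, int t - int k - int j) \<in> A t" by (auto simp: A_def)
    with * show "(\<lambda>g. g (l, int t - int k - int j) k') \<in> borel_measurable (PiM (A t) (\<lambda>_. Pi\<^sub>M {..<d} (\<lambda>_. borel)))"
      by (intro measurable_compose[OF measurable_component_singleton[of _ _ "\<lambda>_. Pi\<^sub>M {..<d} (\<lambda>_. borel)"]
            measurable_component_singleton[of k' "{..<d}" "\<lambda>_. borel"]]) auto
  qed
  \<comment> \<open>Truncated coefficients vanish from lag n on, so the series is a finite sum for
    every outcome and no exceptional null set arises.\<close>
  have eq: "f t (restrict (\<lambda>i. X i \<omega>) (A t)) = h (field (trunc n) t \<omega>)" for t \<omega>
    unfolding f_def
  proof (rule h_cong)
    fix i k assume "i < d" and k: "k \<le> m"
    have "lin_proc d (trunc n l) (eps l) (int t - int k) \<omega> i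
        = (\<Sum>j<n. \<Sum>k'<d. C l j i k' * restrict (\<lambda>i. X i \<omega>) (A t) (l, int t - int k - int j) k')"
      if "l \<le> L" for l
    proof -
      have "lin_proc d (trunc n l) (eps l) (int t - int k) \<omega> i
          = (\<Sum>j<n. \<Sum>k'<d. trunc n l j i k' * eps l (int t - int k - int j) \<omega> k')"
        unfolding lin_proc_def by (intro suminf_finite) (auto simp: trunc_def)
      also have "\<dots> = (\<Sum>j<n. \<Sum>k'<d. C l j i k' * restrict (\<lambda>i. X i \<omega>) (A t) (l, int t - int k - int j) k')"
        using that k by (intro sum.cong refl) (auto simp: trunc_def A_def X_def)
      finally show ?thesis .
    qed
    then show "(\<Sum>l\<le>L. coef t i l * (\<Sum>j<n. \<Sum>k'<d. C l j i k' *
        restrict (\<lambda>i. X i \<omega>) (A t) (l, int t - int k - int j) k')) = field (trunc n) t \<omega> i k"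
      by (simp add: field_def)
  qed
  from indep_var_compose[OF ind f_meas f_meas] show ?thesis
    by (simp add: comp_def eq)
qed

text \<open>Needed to split expectations below. Any positive truncation level would serve; the
  remainder and the truncated value are each square integrable up to a constant.\<close>

lemma integrable_h_field: "integrable M (\<lambda>\<omega>. h (field C t \<omega>))"
proof -
  have "integrable M (\<lambda>\<omega>. h (field C t \<omega>) - h (field (trunc 1) t \<omega>))"
    by (rule square_integrable_imp_integrable[OF borel_measurable_diff[OF measurable_h_field measurable_h_field]
          truncation_error(1)]) simp
  moreover have "integrable M (\<lambda>\<omega>. h (field (trunc 1) t \<omega>))"
    by (rule variance_le_second_moment(1)[OF measurable_h_field truncated_second_moment(1)])
  ultimately have "integrable M (\<lambda>\<omega>. (h (field C t \<omega>) - h (field (trunc 1) t \<omega>)) + h (field (trunc 1) t \<omega>))"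
    by (rule Bochner_Integration.integrable_add)
  then show ?thesis by simp
qed

text \<open>The truncated parts and the remainders are centred separately. The former are
  uncorrelated at distance n + m, the latter are merely small, and
  \<open>(u + v)^2 \<le> 2 u^2 + 2 v^2\<close> joins the two bounds.\<close>

lemma weighted_sum_second_moment:
  fixes a :: "nat \<Rightarrow> real"
  assumes n: "n \<ge> 1" and a: "\<And>t. t \<in> {1..T} \<Longrightarrow> \<bar>a t\<bar> \<le> B"
  defines "S \<equiv> (\<lambda>\<omega>. \<Sum>t=1..T. a t * (h (field C t \<omega>) - expectation (\<lambda>\<omega>. h (field C t \<omega>))))"
  shows "integrable M (\<lambda>\<omega>. (S \<omega>)\<^sup>2)"
    and "expectation (\<lambda>\<omega>. (S \<omega>)\<^sup>2) \<le>
      2 * (B\<^sup>2 * (4 * Q) * real T * (2 * real (n + m) + 1)) + 2 * (B\<^sup>2 * (real T)\<^sup>2 * (Q / (real n)\<^sup>2))"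
proof -
  define Y where "Y t \<omega> = h (field C t \<omega>)" for t \<omega>
  define Yn where "Yn t \<omega> = h (field (trunc n) t \<omega>)" for t \<omega>
  define Z where "Z t \<omega> = Yn t \<omega> - expectation (Yn t)" for t \<omega>
  define R where "R t \<omega> = (Y t \<omega> - Yn t \<omega>) - expectation (\<lambda>\<omega>. Y t \<omega> - Yn t \<omega>)" for t \<omega>
  have meas [measurable]: "Y t \<in> borel_measurable M" "Yn t \<in> borel_measurable M" for t
    using measurable_h_field by (simp_all add: Y_def[abs_def] Yn_def[abs_def])
  note tsm = truncated_second_moment[of n, folded Yn_def]
  note te = truncation_error[OF n, folded Y_def Yn_def]
  note varZ = variance_le_second_moment[OF meas(2) tsm(1)]
  have measR [measurable]: "(\<lambda>\<omega>. Y t \<omega> - Yn t \<omega>) \<in> borel_measurable M" for t by measurable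
  note varR = variance_le_second_moment[of "\<lambda>\<omega>. Y t \<omega> - Yn t \<omega>" 0 for t, OF measR]
  have Z_meas [measurable]: "Z t \<in> borel_measurable M" for t unfolding Z_def by measurable
  have R_meas [measurable]: "R t \<in> borel_measurable M" for t unfolding R_def by measurable
  have Z_int: "integrable M (\<lambda>\<omega>. (Z t \<omega>)\<^sup>2)" for t
    unfolding Z_def by (rule varZ(2))
  have Z_V: "expectation (\<lambda>\<omega>. (Z t \<omega>)\<^sup>2) \<le> 4 * Q" for t
    unfolding Z_def by (rule order.trans[OF varZ(3) tsm(2)])
  have R_int: "integrable M (\<lambda>\<omega>. (R t \<omega>)\<^sup>2)" for t
    unfolding R_def by (rule varR(2)) (use te(1) in simp)
  have R_V: "expectation (\<lambda>\<omega>. (R t \<omega>)\<^sup>2) \<le> Q / (real n)\<^sup>2" for t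
    unfolding R_def using varR(3)[of t] te[of t] by simp
  \<comment> \<open>Centring preserves independence, so the expectation of the product factors into
    two zero means.\<close>
  have orth: "expectation (\<lambda>\<omega>. Z s \<omega> * Z t \<omega>) = 0" if "s + (n + m) \<le> t" for s t
  proof -
    have ind: "indep_var borel (Yn s) borel (Yn t)"
      using truncated_indep[OF that] by (simp add: Yn_def[abs_def])
    have Zc: "Z t = (\<lambda>y. y - expectation (Yn t)) \<circ> Yn t" for t
      by (simp add: Z_def fun_eq_iff)
    have "indep_var borel (Z s) borel (Z t)"
      unfolding Zc by (rule indep_var_compose[OF ind]) auto
    moreover have "integrable M (Z t)" "expectation (Z t) = 0" for t
      using varZ(1)[of t] by (auto simp: Z_def[abs_def] prob_space)
    ultimately show ?thesis
      using indep_var_lebesgue_integral[of "Z s" "Z t"] by simp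
  qed
  define S1 where "S1 \<omega> = (\<Sum>t=1..T. a t * Z t \<omega>)" for \<omega>
  define S2 where "S2 \<omega> = (\<Sum>t=1..T. a t * R t \<omega>)" for \<omega>
  have [measurable]: "S1 \<in> borel_measurable M" "S2 \<in> borel_measurable M"
    unfolding S1_def S2_def by measurable
  have S_eq: "S \<omega> = S1 \<omega> + S2 \<omega>" for \<omega>
  proof -
    have "expectation (\<lambda>\<omega>. Y t \<omega> - Yn t \<omega>) = expectation (Y t) - expectation (Yn t)" for t
      using integrable_h_field[of t] varZ(1)[of t]
      by (intro Bochner_Integration.integral_diff) (auto simp: Y_def[abs_def])
    then have "Y t \<omega> - expectation (Y t) = Z t \<omega> + R t \<omega>" for t
      by (simp add: Z_def R_def)
    then show ?thesis
      unfolding S_def S1_def S2_def sum.distrib[symmetric] distrib_left[symmetric]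
      by (simp add: Y_def[abs_def])
  qed
  have aZ_int: "integrable M (\<lambda>\<omega>. (a t * Z t \<omega>)\<^sup>2)" and aR_int: "integrable M (\<lambda>\<omega>. (a t * R t \<omega>)\<^sup>2)" for t
    using Z_int R_int by (simp_all add: power_mult_distrib)
  have S1_int: "integrable M (\<lambda>\<omega>. (S1 \<omega>)\<^sup>2)"
    unfolding S1_def using aZ_int by (intro integrable_square_sum) auto
  have S2_int: "integrable M (\<lambda>\<omega>. (S2 \<omega>)\<^sup>2)"
    unfolding S2_def using aR_int by (intro integrable_square_sum) auto
  have S1_V: "expectation (\<lambda>\<omega>. (S1 \<omega>)\<^sup>2) \<le> B\<^sup>2 * (4 * Q) * real T * (2 * real (n + m) + 1)"
    unfolding S1_def
    by (rule second_moment_sum_of_locally_correlated[OF Z_meas Z_int Z_V orth a]) auto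
  \<comment> \<open>Cauchy-Schwarz gives one factor T and the T summands the other.\<close>
  have S2_V: "expectation (\<lambda>\<omega>. (S2 \<omega>)\<^sup>2) \<le> B\<^sup>2 * (real T)\<^sup>2 * (Q / (real n)\<^sup>2)"
  proof -
    have "expectation (\<lambda>\<omega>. (S2 \<omega>)\<^sup>2) \<le> real (card {1..T}) * (\<Sum>t=1..T. expectation (\<lambda>\<omega>. (a t * R t \<omega>)\<^sup>2))"
      unfolding S2_def using aR_int by (intro integrable_square_sum) auto
    also have "\<dots> \<le> real (card {1..T}) * (\<Sum>t=1..T. B\<^sup>2 * (Q / (real n)\<^sup>2))"
    proof (intro mult_left_mono sum_mono)
      fix t assume "t \<in> {1..T}"
      from power_mono[OF a[OF this], of 2] have "(a t)\<^sup>2 \<le> B\<^sup>2" by simp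
      then show "expectation (\<lambda>\<omega>. (a t * R t \<omega>)\<^sup>2) \<le> B\<^sup>2 * (Q / (real n)\<^sup>2)"
        using R_V[of t] by (auto simp: power_mult_distrib simp del: times_divide_eq_right intro!: mult_mono)
    qed simp
    also have "\<dots> = B\<^sup>2 * (real T)\<^sup>2 * (Q / (real n)\<^sup>2)"
      by (simp add: power2_eq_square)
    finally show ?thesis .
  qed
  have le: "(S \<omega>)\<^sup>2 \<le> 2 * (S1 \<omega>)\<^sup>2 + 2 * (S2 \<omega>)\<^sup>2" for \<omega>
    unfolding S_eq using sum_squares_bound[of "S1 \<omega>" "S2 \<omega>"] by (simp add: power2_sum)
  have int: "integrable M (\<lambda>\<omega>. 2 * (S1 \<omega>)\<^sup>2 + 2 * (S2 \<omega>)\<^sup>2)"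
    using S1_int S2_int by simp
  have [measurable]: "S \<in> borel_measurable M"
    unfolding S_eq[abs_def] by measurable
  show S_int: "integrable M (\<lambda>\<omega>. (S \<omega>)\<^sup>2)"
    by (rule Bochner_Integration.integrable_bound[OF int]) (use le in auto)
  have "expectation (\<lambda>\<omega>. (S \<omega>)\<^sup>2) \<le> expectation (\<lambda>\<omega>. 2 * (S1 \<omega>)\<^sup>2 + 2 * (S2 \<omega>)\<^sup>2)"
    by (intro integral_mono S_int int le)
  also have "\<dots> = 2 * expectation (\<lambda>\<omega>. (S1 \<omega>)\<^sup>2) + 2 * expectation (\<lambda>\<omega>. (S2 \<omega>)\<^sup>2)"
    using S1_int S2_int by simp
  also note add_mono[OF mult_left_mono[OF S1_V, of 2] mult_left_mono[OF S2_V, of 2]]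
  finally show "expectation (\<lambda>\<omega>. (S \<omega>)\<^sup>2) \<le>
      2 * (B\<^sup>2 * (4 * Q) * real T * (2 * real (n + m) + 1)) + 2 * (B\<^sup>2 * (real T)\<^sup>2 * (Q / (real n)\<^sup>2))"
    by simp
qed

lemma weighted_sum_second_moment_rate:
  fixes a :: "nat \<Rightarrow> real"
  assumes T: "T \<ge> 1" and a: "\<And>t. t \<in> {1..T} \<Longrightarrow> \<bar>a t\<bar> \<le> B"
  defines "S \<equiv> (\<lambda>\<omega>. \<Sum>t=1..T. a t * (h (field C t \<omega>) - expectation (\<lambda>\<omega>. h (field C t \<omega>))))"
  shows "integrable M (\<lambda>\<omega>. (S \<omega>)\<^sup>2)"
    and "expectation (\<lambda>\<omega>. (S \<omega>)\<^sup>2) \<le> B\<^sup>2 * Q * (16 * real m + 42) * (real T * sqrt (real T))"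
proof -
  \<comment> \<open>Rounding up gives \<open>n^2 \<ge> T\<close>, so the remainder contributes only
    order T, while the range of dependence stays of order \<open>sqrt T\<close>.\<close>
  define n where "n = nat \<lceil>sqrt (real T)\<rceil>"
  have s1: "sqrt (real T) \<ge> 1" using T by simp
  have n: "sqrt (real T) \<le> real n" "real n \<le> sqrt (real T) + 1" "n \<ge> 1"
    using s1 unfolding n_def by linarith+
  note moment = weighted_sum_second_moment[where a = a and T = T, OF n(3) a]
  show "integrable M (\<lambda>\<omega>. (S \<omega>)\<^sup>2)"
    unfolding S_def by (rule moment(1))
  have S_le: "expectation (\<lambda>\<omega>. (S \<omega>)\<^sup>2) \<le>
      2 * (B\<^sup>2 * (4 * Q) * real T * (2 * real (n + m) + 1)) + 2 * (B\<^sup>2 * (real T)\<^sup>2 * (Q / (real n)\<^sup>2))"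
    unfolding S_def by (rule moment(2))
  have "real T = (sqrt (real T))\<^sup>2" by simp
  also have "\<dots> \<le> (real n)\<^sup>2" using n(1) s1 by (intro power_mono) auto
  finally have Tn: "real T \<le> (real n)\<^sup>2" .
  have BQ: "0 \<le> B\<^sup>2 * Q" using Q_nonneg by simp
  have "2 * real (n + m) + 1 \<le> 2 * sqrt (real T) + (2 * real m + 3) * 1"
    using n by simp
  also have "\<dots> \<le> 2 * sqrt (real T) + (2 * real m + 3) * sqrt (real T)"
    using s1 by (intro add_left_mono mult_left_mono) auto
  finally have "2 * real (n + m) + 1 \<le> (2 * real m + 5) * sqrt (real T)"
    by (simp add: algebra_simps)
  then have "B\<^sup>2 * (4 * Q) * real T * (2 * real (n + m) + 1)
      \<le> B\<^sup>2 * (4 * Q) * real T * ((2 * real m + 5) * sqrt (real T))"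
    using BQ by (intro mult_left_mono) auto
  moreover have "B\<^sup>2 * (real T)\<^sup>2 * (Q / (real n)\<^sup>2) \<le> B\<^sup>2 * Q * (real T * sqrt (real T))"
  proof -
    have "(real T)\<^sup>2 / (real n)\<^sup>2 \<le> (real T)\<^sup>2 / real T"
      using Tn T n by (intro divide_left_mono) auto
    also have "\<dots> = real T * 1" using T by (simp add: power2_eq_square)
    also have "\<dots> \<le> real T * sqrt (real T)" using s1 by (intro mult_left_mono) auto
    finally have "B\<^sup>2 * Q * ((real T)\<^sup>2 / (real n)\<^sup>2) \<le> B\<^sup>2 * Q * (real T * sqrt (real T))"
      using BQ by (rule mult_left_mono)
    then show ?thesis by (simp add: mult_ac)
  qed
  ultimately have "expectation (\<lambda>\<omega>. (S \<omega>)\<^sup>2) \<le>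
      2 * (B\<^sup>2 * (4 * Q) * real T * ((2 * real m + 5) * sqrt (real T))) + 2 * (B\<^sup>2 * Q * (real T * sqrt (real T)))"
    using S_le by linarith
  \<comment> \<open>The constant is 2 * 4 * (2m + 5) + 2.\<close>
  also have "\<dots> = B\<^sup>2 * Q * (16 * real m + 42) * (real T * sqrt (real T))"
    by (simp add: algebra_simps)
  finally show "expectation (\<lambda>\<omega>. (S \<omega>)\<^sup>2) \<le> B\<^sup>2 * Q * (16 * real m + 42) * (real T * sqrt (real T))" .
qed

text \<open>The regressors are deterministic and uniformly bounded, so they serve as the weights of
  the moment bound, with one constant for all coordinates j. Markov's inequality is applied once, to
  the sum of squares over all p coordinates.\<close>

lemma ols_consistent:
  fixes x :: "nat \<Rightarrow> nat \<Rightarrow> nat \<Rightarrow> real" and \<beta> :: "nat \<Rightarrow> nat \<Rightarrow> real" and p :: "nat \<Rightarrow> nat"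
    and e :: "nat \<Rightarrow> 'a \<Rightarrow> real"
  assumes e: "\<And>t \<omega>. e t \<omega> = h (field C t \<omega>) - expectation (\<lambda>\<omega>. h (field C t \<omega>))"
    and x: "\<And>T t j. t \<in> {1..T} \<Longrightarrow> j < p T \<Longrightarrow> \<bar>x T t j\<bar> \<le> B"
    and a: "0 < a"
      "\<And>T k. T \<ge> 1 \<Longrightarrow> is_eigenvalue (p T) (\<lambda>i j. gram T (x T) i j / real T) k \<Longrightarrow> a \<le> k"
    and p: "(\<lambda>T. real (p T) / sqrt (real T)) \<longlonglongrightarrow> 0"
    and \<eta>: "\<eta> > 0"
  shows "(\<lambda>T. prob {\<omega>\<in>space M. sqrt (\<Sum>j<p T.
      (ols T (p T) (x T) (\<lambda>t. (\<Sum>i<p T. x T t i * \<beta> T i) + e t \<omega>) j - \<beta> T j)\<^sup>2) > \<eta>}) \<longlonglongrightarrow> 0"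
    (is "?P \<longlonglongrightarrow> 0")
proof -
  define E0 where "E0 = B\<^sup>2 * Q * (16 * real m + 42)"
  have e_meas [measurable]: "e t \<in> borel_measurable M" for t
    unfolding e[abs_def] using measurable_h_field by (intro borel_measurable_diff) auto
  have bound: "?P T \<le> E0 / (\<eta> * a)\<^sup>2 * (real (p T) / sqrt (real T))" if T: "T \<ge> 1" for T
  proof -
    define w where "w j \<omega> = (\<Sum>t=1..T. x T t j * e t \<omega>)" for j \<omega>
    have [measurable]: "w j \<in> borel_measurable M" for j unfolding w_def by measurable
    \<comment> \<open>By \<open>ols_error_bound\<close>, an estimation error above
      \<open>\<eta>\<close> forces the squared norm of \<open>X^T e\<close> to reach this
      level.\<close>
    define c where "c = (\<eta> * (a * real T))\<^sup>2"
    have c: "c > 0" using \<eta> a T by (simp add: c_def)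
    have w_int: "integrable M (\<lambda>\<omega>. (w j \<omega>)\<^sup>2)"
      and w_le: "expectation (\<lambda>\<omega>. (w j \<omega>)\<^sup>2) \<le> E0 * (real T * sqrt (real T))" if "j < p T" for j
      unfolding w_def e E0_def using that x T
      by (intro weighted_sum_second_moment_rate; auto)+
    have "?P T \<le> prob {\<omega>\<in>space M. (\<Sum>j<p T. (w j \<omega>)\<^sup>2) \<ge> c}"
    proof (rule finite_measure_mono)
      show "{\<omega>\<in>space M. (\<Sum>j<p T. (w j \<omega>)\<^sup>2) \<ge> c} \<in> events"
        by measurable
      show "{\<omega>\<in>space M. sqrt (\<Sum>j<p T.
          (ols T (p T) (x T) (\<lambda>t. (\<Sum>i<p T. x T t i * \<beta> T i) + e t \<omega>) j - \<beta> T j)\<^sup>2) > \<eta>}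
          \<subseteq> {\<omega>\<in>space M. (\<Sum>j<p T. (w j \<omega>)\<^sup>2) \<ge> c}"
      proof safe
        fix \<omega>
        define b2 where "b2 = (\<Sum>j<p T.
          (ols T (p T) (x T) (\<lambda>t. (\<Sum>i<p T. x T t i * \<beta> T i) + e t \<omega>) j - \<beta> T j)\<^sup>2)"
        assume "\<eta> < sqrt (\<Sum>j<p T.
          (ols T (p T) (x T) (\<lambda>t. (\<Sum>i<p T. x T t i * \<beta> T i) + e t \<omega>) j - \<beta> T j)\<^sup>2)"
        then have "\<eta>\<^sup>2 \<le> (sqrt b2)\<^sup>2"
          unfolding b2_def[symmetric] using \<eta> by (intro power_mono) auto
        also have "\<dots> = b2" by (simp add: b2_def sum_nonneg)
        also have "\<dots> \<le> (\<Sum>j<p T. (w j \<omega>)\<^sup>2) / (a * real T)\<^sup>2"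
          unfolding b2_def w_def using T a by (intro ols_error_bound) auto
        finally show "c \<le> (\<Sum>j<p T. (w j \<omega>)\<^sup>2)"
          using a T by (simp add: c_def power_mult_distrib pos_le_divide_eq)
      qed
    qed
    also have "\<dots> \<le> expectation (\<lambda>\<omega>. \<Sum>j<p T. (w j \<omega>)\<^sup>2) / c"
      using w_int c by (intro integral_Markov_inequality_measure[where A = "{}"])
        (auto intro!: sum_nonneg Bochner_Integration.integrable_sum)
    also have "expectation (\<lambda>\<omega>. \<Sum>j<p T. (w j \<omega>)\<^sup>2) = (\<Sum>j<p T. expectation (\<lambda>\<omega>. (w j \<omega>)\<^sup>2))"
      using w_int by (intro Bochner_Integration.integral_sum) auto
    also have "(\<Sum>j<p T. expectation (\<lambda>\<omega>. (w j \<omega>)\<^sup>2)) / c \<le> (\<Sum>j<p T. E0 * (real T * sqrt (real T))) / c"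
      using w_le c by (intro divide_right_mono sum_mono) auto
    also have "\<dots> = E0 / (\<eta> * a)\<^sup>2 * (real (p T) / sqrt (real T))"
    proof -
      have "real T * sqrt (real T) / (real T)\<^sup>2 = 1 / sqrt (real T)"
        using T by (simp add: power2_eq_square field_simps)
      moreover have "(\<Sum>j<p T. E0 * (real T * sqrt (real T))) / c
          = E0 / (\<eta> * a)\<^sup>2 * (real (p T) * (real T * sqrt (real T) / (real T)\<^sup>2))"
        by (simp add: c_def power_mult_distrib mult_ac)
      ultimately show ?thesis by simp
    qed
    finally show ?thesis .
  qed
  show ?thesis
  proof (rule tendsto_sandwich[of "\<lambda>_. 0"])
    show "\<forall>\<^sub>F T in sequentially. ?P T \<le> E0 / (\<eta> * a)\<^sup>2 * (real (p T) / sqrt (real T))"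
      using eventually_ge_at_top[of 1] by eventually_elim (rule bound)
    show "(\<lambda>T. E0 / (\<eta> * a)\<^sup>2 * (real (p T) / sqrt (real T))) \<longlonglongrightarrow> 0"
      by (rule tendsto_mult_right_zero[OF p])
  qed auto
qed

end

section \<open>Growth and moment conditions\<close>

text \<open>Once p is at least 3, its logarithm is at least 1, so \<open>sqrt p\<close> is itself at
  most \<open>(ln T) powr (1 - a)\<close>, hence at most \<open>ln T\<close>.\<close>

lemma dimension_over_sqrt_tendsto_0:
  fixes p :: "nat \<Rightarrow> nat"
  assumes p_lim: "filterlim p at_top sequentially" and a: "0 < a"
    and rate: "(\<lambda>T. ln (real (p T)) * sqrt (real (p T))) \<in> o[sequentially](\<lambda>T. ln (real T) powr (1 - a))"
  shows "(\<lambda>T. real (p T) / sqrt (real T)) \<longlonglongrightarrow> 0"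
proof (rule tendsto_sandwich[of "\<lambda>_. 0"])
  have ln3: "1 \<le> ln (real n)" if "n \<ge> 3" for n :: nat
  proof -
    have "exp 1 \<le> real n" using exp_le that by linarith
    then show ?thesis using that by (subst ln_ge_iff) auto
  qed
  have "\<forall>\<^sub>F T in sequentially. 3 \<le> p T"
    using p_lim by (simp add: filterlim_at_top)
  moreover have "\<forall>\<^sub>F T in sequentially. norm (ln (real (p T)) * sqrt (real (p T))) \<le> 1 * norm (ln (real T) powr (1 - a))"
    using landau_o.smallD[OF rate, of 1] by simp
  ultimately show "\<forall>\<^sub>F T in sequentially. real (p T) / sqrt (real T) \<le> (ln (real T))\<^sup>2 / sqrt (real T)"
    using eventually_ge_at_top[of 3]
  proof eventually_elim
    case (elim T)
    have "sqrt (real (p T)) \<le> ln (real (p T)) * sqrt (real (p T))"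
      using ln3[OF elim(1)] mult_right_mono[of 1 "ln (real (p T))" "sqrt (real (p T))"] by simp
    also have "\<dots> \<le> ln (real T) powr (1 - a)"
      using elim(2) by simp
    also have "\<dots> \<le> ln (real T) powr 1"
      using ln3[OF elim(3)] a by (intro powr_mono) auto
    also have "\<dots> = ln (real T)"
      using ln3[OF elim(3)] by simp
    finally have "(sqrt (real (p T)))\<^sup>2 \<le> (ln (real T))\<^sup>2"
      by (intro power_mono) auto
    then show ?case by (intro divide_right_mono) auto
  qed
  show "(\<lambda>T. (ln (real T))\<^sup>2 / sqrt (real T)) \<longlonglongrightarrow> 0"
    by real_asymp
qed auto

lemma powr_decay_le_inverse_square:
  fixes \<theta> :: real
  assumes "\<theta> > 0"
  shows "real (max j 1) powr (- 7/2 - \<theta>) \<le> 4 * (1 / (real (Suc j))\<^sup>2)"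
proof -
  define y where "y = real (max j 1)"
  \<comment> \<open>The factor 2 between j + 1 and \<open>max j 1\<close> is attained at j = 1; its
    square is the constant 4.\<close>
  have y: "y \<ge> 1" "real (Suc j) \<le> 2 * y" by (auto simp: y_def)
  have "y powr (- 7/2 - \<theta>) \<le> y powr (- 2)"
    using y assms by (intro powr_mono) auto
  also have "\<dots> = 1 / y\<^sup>2"
    using y by (simp add: powr_minus divide_inverse)
  also have "\<dots> \<le> 4 * (1 / (real (Suc j))\<^sup>2)"
  proof -
    have "(real (Suc j))\<^sup>2 \<le> (2 * y)\<^sup>2" using y by (intro power_mono) auto
    then have "4 / (2 * y)\<^sup>2 \<le> 4 / (real (Suc j))\<^sup>2"
      using y by (intro divide_left_mono) auto
    then show ?thesis by (simp add: power_mult_distrib)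
  qed
  finally show ?thesis by (simp add: y_def)
qed

lemma square_le_one_plus_powr:
  fixes z \<delta> :: real
  assumes "\<delta> > 0"
  shows "z\<^sup>2 \<le> 1 + \<bar>z\<bar> powr (2 + \<delta>)"
proof (cases "\<bar>z\<bar> \<le> 1")
  case True
  then have "z\<^sup>2 \<le> 1" by (simp add: abs_square_le_1)
  also have "\<dots> \<le> 1 + \<bar>z\<bar> powr (2 + \<delta>)" by simp
  finally show ?thesis .
next
  case False
  then have "z\<^sup>2 = \<bar>z\<bar> powr 2" by simp
  also have "\<dots> \<le> \<bar>z\<bar> powr (2 + \<delta>)" using False assms by (intro powr_mono) auto
  finally show ?thesis by simp
qed

lemma (in prob_space) second_moment_of_powr_moment:
  fixes X :: "'a \<Rightarrow> real"
  assumes \<delta>: "\<delta> > 0" and [measurable]: "X \<in> borel_measurable M"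
    and int: "integrable M (\<lambda>\<omega>. \<bar>X \<omega>\<bar> powr (2 + \<delta>))"
  shows "integrable M (\<lambda>\<omega>. (X \<omega>)\<^sup>2)"
    and "expectation (\<lambda>\<omega>. (X \<omega>)\<^sup>2) \<le> 1 + expectation (\<lambda>\<omega>. \<bar>X \<omega>\<bar> powr (2 + \<delta>))"
proof -
  have int': "integrable M (\<lambda>\<omega>. 1 + \<bar>X \<omega>\<bar> powr (2 + \<delta>))" using int by simp
  show *: "integrable M (\<lambda>\<omega>. (X \<omega>)\<^sup>2)"
    by (rule Bochner_Integration.integrable_bound[OF int'])
       (use square_le_one_plus_powr[OF \<delta>] in auto)
  have "expectation (\<lambda>\<omega>. (X \<omega>)\<^sup>2) \<le> expectation (\<lambda>\<omega>. 1 + \<bar>X \<omega>\<bar> powr (2 + \<delta>))"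
    by (intro integral_mono * int' square_le_one_plus_powr \<delta>)
  also have "\<dots> = 1 + expectation (\<lambda>\<omega>. \<bar>X \<omega>\<bar> powr (2 + \<delta>))"
    using int by (simp add: prob_space)
  finally show "expectation (\<lambda>\<omega>. (X \<omega>)\<^sup>2) \<le> 1 + expectation (\<lambda>\<omega>. \<bar>X \<omega>\<bar> powr (2 + \<delta>))" .
qed

theorem theorem3:
  fixes M :: "'a measure"
    and d L m q :: nat
    and phi :: "nat \<Rightarrow> nat \<Rightarrow> real"                      \<comment> \<open>phi \<nu> \<ell>\<close>
    and r :: "nat \<Rightarrow> nat \<Rightarrow> real"                        \<comment> \<open>sites r_\<ell> in [0,1]^q\<close>
    and dd :: "(nat \<Rightarrow> real) \<Rightarrow> (nat \<Rightarrow> real) \<Rightarrow> real"     \<comment> \<open>the function d(s,r)\<close>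
    and s :: "nat \<Rightarrow> nat \<Rightarrow> real"                        \<comment> \<open>locations s_t in [0,1]^q\<close>
    and C :: "nat \<Rightarrow> nat \<Rightarrow> nat \<Rightarrow> nat \<Rightarrow> real"          \<comment> \<open>C \<ell> j \<nu> k = entry (\<nu>,k) of C_j^(\<ell>)\<close>
    and eps :: "nat \<Rightarrow> int \<Rightarrow> 'a \<Rightarrow> nat \<Rightarrow> real"         \<comment> \<open>eps \<ell> t \<omega> \<nu>\<close>
    and Sig Shalf :: "nat \<Rightarrow> int \<Rightarrow> nat \<Rightarrow> nat \<Rightarrow> real"   \<comment> \<open>Sigma_t^(\<ell>) and its square root\<close>
    and u :: "nat \<Rightarrow> int \<Rightarrow> 'a \<Rightarrow> nat \<Rightarrow> real"
    and H :: "(nat \<Rightarrow> nat \<Rightarrow> real) \<Rightarrow> nat \<Rightarrow> real"       \<comment> \<open>H applied to a d x (m+1) matrix\<close>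
    and LH :: real
    and U :: "int \<Rightarrow> (nat \<Rightarrow> real) \<Rightarrow> 'a \<Rightarrow> nat \<Rightarrow> real"   \<comment> \<open>U_t(s), coordinate \<nu>\<close>
    and err :: "nat \<Rightarrow> 'a \<Rightarrow> nat \<Rightarrow> real"               \<comment> \<open>epsilon_t^(\<nu>)\<close>
    and p :: "nat \<Rightarrow> nat"
    and x :: "nat \<Rightarrow> nat \<Rightarrow> nat \<Rightarrow> real"                  \<comment> \<open>x T t j\<close>
    and beta :: "nat \<Rightarrow> nat \<Rightarrow> nat \<Rightarrow> real"               \<comment> \<open>beta T \<nu> j\<close>
    and \<nu> :: nat
  assumes M: "prob_space M"
    and d_pos: "d \<ge> 1" and nu: "\<nu> < d"
    \<comment> \<open>spatial structure\<close>
    and r_box: "\<forall>l\<in>{1..L}. \<forall>i<q. r l i \<in> {0..1}"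
    and s_box: "\<forall>t. \<forall>i<q. s t i \<in> {0..1}"
    and dd_range: "\<forall>a b. (\<forall>i<q. a i \<in> {0..1}) \<longrightarrow> (\<forall>i<q. b i \<in> {0..1}) \<longrightarrow> dd a b \<in> {0..1}"
    \<comment> \<open>error model\<close>
    and U_def: "\<forall>t z \<omega> i. U t z \<omega> i =
        (\<Sum>l=1..L. phi i l * dd z (r l) * lin_proc d (C l) (eps l) t \<omega> i)
        + lin_proc d (C 0) (eps 0) t \<omega> i"
    and err_def: "\<forall>t \<omega> i. err t \<omega> i =
        H (\<lambda>i' k. U (int t - int k) (s t) \<omega> i') i
        - prob_space.expectation M (\<lambda>\<omega>'. H (\<lambda>i' k. U (int t - int k) (s t) \<omega>' i') i)"
    \<comment> \<open>(E1)\<close>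
    and E1_indep: "prob_space.indep_vars M (\<lambda>_. Pi\<^sub>M {..<d} (\<lambda>_. borel))
        (\<lambda>(l, t) \<omega>. restrict (eps l t \<omega>) {..<d}) ({..L} \<times> UNIV)"
    and E1_mean: "\<forall>l\<le>L. \<forall>t. \<forall>i<d. integrable M (\<lambda>\<omega>. eps l t \<omega> i)
        \<and> prob_space.expectation M (\<lambda>\<omega>. eps l t \<omega> i) = 0"
    and E1_sqrt: "\<forall>l\<le>L. \<forall>t. pos_def d (Shalf l t) \<and> pos_def d (Sig l t)
        \<and> (\<forall>i<d. \<forall>j<d. Sig l t i j = (\<Sum>k<d. Shalf l t i k * Shalf l t k j))"
    and E1_repr: "\<forall>l\<le>L. \<forall>t. \<forall>\<omega>\<in>space M. \<forall>i<d.
        eps l t \<omega> i = (\<Sum>k<d. Shalf l t i k * u l t \<omega> k)"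
    and E1_u: "\<forall>l\<le>L. \<forall>t. prob_space.indep_vars M (\<lambda>_. borel) (\<lambda>i \<omega>. u l t \<omega> i) {..<d}
        \<and> (\<forall>i<d. integrable M (\<lambda>\<omega>. u l t \<omega> i)
             \<and> prob_space.expectation M (\<lambda>\<omega>. u l t \<omega> i) = 0)"
    \<comment> \<open>(E2)\<close>
    and E2: "\<exists>\<delta>>0. (\<exists>K. \<forall>l\<le>L. \<forall>t. \<forall>i<d.
          integrable M (\<lambda>\<omega>. \<bar>eps l t \<omega> i\<bar> powr (2 + \<delta>))
          \<and> prob_space.expectation M (\<lambda>\<omega>. \<bar>eps l t \<omega> i\<bar> powr (2 + \<delta>)) \<le> K)
        \<and> (\<exists>Xi :: 'a \<Rightarrow> nat \<Rightarrow> nat \<Rightarrow> real.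
            (\<lambda>\<omega>. \<lambda>(i, k). Xi \<omega> i k) \<in> M \<rightarrow>\<^sub>M Pi\<^sub>M UNIV (\<lambda>_::nat \<times> nat. borel)
            \<and> prob_space.indep_set M
                (sets (vimage_algebra (space M) (\<lambda>\<omega>. \<lambda>(i, k). Xi \<omega> i k)
                   (Pi\<^sub>M UNIV (\<lambda>_::nat \<times> nat. borel))))
                (sets (vimage_algebra (space M) (\<lambda>\<omega>. \<lambda>(t, z, i). U t z \<omega> i)
                   (Pi\<^sub>M UNIV (\<lambda>_::int \<times> (nat \<Rightarrow> real) \<times> nat. borel))))
            \<and> (\<forall>i<d. integrable M (\<lambda>\<omega>. \<bar>H (Xi \<omega>) i\<bar> powr (2 + \<delta>))))"
    \<comment> \<open>(E3)\<close>
    and E3: "d = 1 \<longrightarrow> (\<exists>K. \<forall>l\<le>L. \<forall>t. integrable M (\<lambda>\<omega>. (eps l t \<omega> 0)\<^sup>2)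
        \<and> prob_space.expectation M (\<lambda>\<omega>. (eps l t \<omega> 0)\<^sup>2) \<le> K)"
    \<comment> \<open>(E4)\<close>
    and E4a: "d = 1 \<longrightarrow> (\<exists>\<sigma>>0. \<forall>t. prob_space.expectation M (\<lambda>\<omega>. (eps 0 t \<omega> 0)\<^sup>2) \<ge> \<sigma>\<^sup>2)"
    and E4b: "d > 1 \<longrightarrow> (\<exists>lam>0. \<forall>t. \<forall>k. is_eigenvalue d (Sig 0 t) k \<longrightarrow> k \<ge> lam)"
    \<comment> \<open>(E5)\<close>
    and E5: "\<exists>pdens :: nat \<Rightarrow> int \<Rightarrow> nat \<Rightarrow> real \<Rightarrow> real.
        (\<forall>l\<le>L. \<forall>t. \<forall>i<d. (\<forall>z. pdens l t i z \<ge> 0)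
           \<and> distributed M lborel (\<lambda>\<omega>. eps l t \<omega> i) (\<lambda>z. ennreal (pdens l t i z)))
        \<and> (\<exists>K. \<forall>l\<le>L. \<forall>i<d. \<forall>t. \<forall>y::real.
             (LINT z|lborel. \<bar>pdens l t i (z + y) - pdens l t i z\<bar>) \<le> K * \<bar>y\<bar>)"
    \<comment> \<open>(E6)\<close>
    and E6: "\<exists>\<theta>>0. \<exists>Cc. \<forall>l\<le>L. \<forall>i<d. \<forall>k<d. \<forall>j.
        \<bar>C l j i k\<bar> \<le> Cc * real (max j 1) powr (- 7/2 - \<theta>)"
    \<comment> \<open>(E7)\<close>
    and E7: "\<forall>i<d. \<forall>A B. \<bar>H A i - H B i\<bar>
        \<le> LH * sqrt (\<Sum>i'<d. \<Sum>k\<le>m. (A i' k - B i' k)\<^sup>2)"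
    \<comment> \<open>(R)\<close>
    and R_bdd: "\<exists>Bx. \<forall>T. \<forall>t\<in>{1..T}. \<forall>j<p T. \<bar>x T t j\<bar> \<le> Bx"
    and R_rank: "\<forall>T\<ge>1. full_col_rank T (p T) (x T)"
    and R_cov: "\<exists>Sigx :: nat \<Rightarrow> nat \<Rightarrow> real. \<exists>\<eta>\<ge>0. \<exists>Cx.
        (\<forall>T\<ge>1. pos_def (p T) Sigx
           \<and> op_norm2 (p T) (\<lambda>i j. gram T (x T) i j / real T - Sigx i j)
               \<le> Cx * real (p T) powr \<eta> / sqrt (real T))"
    and R_spec: "\<exists>a1 a2. 0 < a1 \<and> a1 \<le> a2 \<and> (\<forall>T\<ge>1. \<forall>k.
        is_eigenvalue (p T) (\<lambda>i j. gram T (x T) i j / real T) k \<longrightarrow> k \<in> {a1..a2})"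
    \<comment> \<open>bound on x_{tj} \<epsilon>_t^(\<nu>')\<close>
    and bdd: "\<forall>T. \<forall>t\<in>{1..T}. \<forall>j<p T. \<forall>i<d. AE \<omega> in M. \<bar>x T t j * err t \<omega> i\<bar> \<le> 1"
    \<comment> \<open>asymptotic regime\<close>
    and p_lim: "filterlim p at_top sequentially"
    and rate: "\<exists>a. 0 < a \<and> a < 1 \<and>
        (\<lambda>T. ln (real (p T)) * sqrt (real (p T))) \<in> o[sequentially](\<lambda>T. ln (real T) powr (1 - a))"
  shows "(\<forall>T \<eta>. {\<omega>\<in>space M. sqrt (\<Sum>j<p T.
              (ols T (p T) (x T) (\<lambda>t. (\<Sum>i<p T. x T t i * beta T \<nu> i) + err t \<omega> \<nu>) j
               - beta T \<nu> j)\<^sup>2) > \<eta>} \<in> sets M)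
    \<and> (\<forall>\<eta>>0. (\<lambda>T. measure M {\<omega>\<in>space M. sqrt (\<Sum>j<p T.
              (ols T (p T) (x T) (\<lambda>t. (\<Sum>i<p T. x T t i * beta T \<nu> i) + err t \<omega> \<nu>) j
               - beta T \<nu> j)\<^sup>2) > \<eta>}) \<longlonglongrightarrow> 0)"
proof -
  interpret prob_space M by (rule M)
  obtain \<delta> K0 where \<delta>: "\<delta> > 0"
    and K0: "\<And>l t i. l \<le> L \<Longrightarrow> i < d \<Longrightarrow> integrable M (\<lambda>\<omega>. \<bar>eps l t \<omega> i\<bar> powr (2 + \<delta>))
          \<and> expectation (\<lambda>\<omega>. \<bar>eps l t \<omega> i\<bar> powr (2 + \<delta>)) \<le> K0"
    using E2 by metis
  obtain \<theta> C0 where \<theta>: "\<theta> > 0"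
    and C0: "\<And>l i k j. l \<le> L \<Longrightarrow> i < d \<Longrightarrow> k < d \<Longrightarrow> \<bar>C l j i k\<bar> \<le> C0 * real (max j 1) powr (- 7/2 - \<theta>)"
    using E6 by metis
  obtain Bx where Bx: "\<And>T t j. t \<in> {1..T} \<Longrightarrow> j < p T \<Longrightarrow> \<bar>x T t j\<bar> \<le> Bx"
    using R_bdd by metis
  obtain a1 a2 where a1: "0 < a1" and spec: "\<And>T k. T \<ge> 1 \<Longrightarrow>
      is_eigenvalue (p T) (\<lambda>i j. gram T (x T) i j / real T) k \<Longrightarrow> k \<in> {a1..a2}"
    using R_spec by metis
  obtain a where a: "0 < a"
    "(\<lambda>T. ln (real (p T)) * sqrt (real (p T))) \<in> o[sequentially](\<lambda>T. ln (real T) powr (1 - a))"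
    using rate by blast
  \<comment> \<open>Index 0 stands for the local noise, which enters with coefficient 1.\<close>
  define coef where "coef t i l = (if l = 0 then 1 else phi i l * dd (s t) (r l))" for t i l
  \<comment> \<open>The summand 1 covers the noise coefficient; the sum covers the spatial ones,
    since \<open>dd\<close> takes values in [0,1].\<close>
  define Bc where "Bc = 1 + (\<Sum>i<d. \<Sum>l\<le>L. \<bar>phi i l\<bar>)"
  have eps_meas: "(\<lambda>\<omega>. eps l t \<omega> k) \<in> borel_measurable M" if "l \<le> L" "k < d" for l t k
    using E1_mean that by blast
  have phi_le: "\<bar>phi i l\<bar> \<le> Bc" if "l \<le> L" "i < d" for i l
  proof -
    have "\<bar>phi i l\<bar> \<le> (\<Sum>l\<le>L. \<bar>phi i l\<bar>)"
      using that by (intro member_le_sum) auto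
    also have "\<dots> \<le> (\<Sum>i<d. \<Sum>l\<le>L. \<bar>phi i l\<bar>)"
      using that by (intro member_le_sum[of i "{..<d}" "\<lambda>i. \<Sum>l\<le>L. \<bar>phi i l\<bar>"]) (auto intro: sum_nonneg)
    finally show ?thesis by (simp add: Bc_def)
  qed
  \<comment> \<open>The constants obtained from the assumptions have no known sign, hence the
    absolute values. The added 1 comes from
    \<open>z^2 \<le> 1 + \<bar>z\<bar> powr (2 + \<delta>)\<close>, the factor 4 from
    \<open>powr_decay_le_inverse_square\<close>.\<close>
  interpret spatial_linear_field M d L m eps C coef "\<lambda>A. H A \<nu>" "1 + \<bar>K0\<bar>" "4 * \<bar>C0\<bar>" Bc "\<bar>LH\<bar>"
  proof unfold_locales
    fix l t k assume lk: "l \<le> L" "k < d"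
    note sm = second_moment_of_powr_moment[OF \<delta> eps_meas[OF lk] conjunct1[OF K0[OF lk]]]
    show "integrable M (\<lambda>\<omega>. (eps l t \<omega> k)\<^sup>2)" by (rule sm)
    show "expectation (\<lambda>\<omega>. (eps l t \<omega> k)\<^sup>2) \<le> 1 + \<bar>K0\<bar>"
      using sm(2)[of t] conjunct2[OF K0[OF lk, of t]] by linarith
  next
    fix l j i k assume lik: "l \<le> L" "i < d" "k < d"
    have "\<bar>C l j i k\<bar> \<le> \<bar>C0\<bar> * real (max j 1) powr (- 7/2 - \<theta>)"
      by (rule order.trans[OF C0[OF lik]]) (simp add: mult_right_mono)
    also have "\<dots> \<le> \<bar>C0\<bar> * (4 * (1 / (real (Suc j))\<^sup>2))"
      by (intro mult_left_mono powr_decay_le_inverse_square \<theta>) simp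
    finally show "\<bar>C l j i k\<bar> \<le> 4 * \<bar>C0\<bar> * (1 / (real (Suc j))\<^sup>2)" by (simp add: mult_ac)
  next
    fix t l i assume li: "l \<le> L" "i < d"
    show "\<bar>coef t i l\<bar> \<le> Bc"
    proof (cases "l = 0")
      case True
      then show ?thesis by (simp add: coef_def Bc_def sum_nonneg)
    next
      case False
      with li have "dd (s t) (r l) \<in> {0..1}"
        using dd_range r_box s_box by simp
      then have "\<bar>phi i l\<bar> * \<bar>dd (s t) (r l)\<bar> \<le> \<bar>phi i l\<bar> * 1"
        by (intro mult_left_mono) auto
      with False phi_le[OF li] show ?thesis by (simp add: coef_def abs_mult)
    qed
  next
    fix A B
    have "\<bar>H A \<nu> - H B \<nu>\<bar> \<le> LH * sqrt (\<Sum>i<d. \<Sum>k\<le>m. (A i k - B i k)\<^sup>2)"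
      using E7 nu by blast
    also have "\<dots> \<le> \<bar>LH\<bar> * sqrt (\<Sum>i<d. \<Sum>k\<le>m. (A i k - B i k)\<^sup>2)"
      by (intro mult_right_mono) (auto intro!: sum_nonneg)
    finally show "\<bar>H A \<nu> - H B \<nu>\<bar> \<le> \<bar>LH\<bar> * sqrt (\<Sum>i<d. \<Sum>k\<le>m. (A i k - B i k)\<^sup>2)" .
  qed (use E1_indep eps_meas in auto)
  have U_field: "(\<lambda>i k. U (int t - int k) (s t) \<omega> i) = field C t \<omega>" for t \<omega>
  proof (intro ext)
    fix i k
    have "{..L} = insert 0 {1..L}" by auto
    then show "U (int t - int k) (s t) \<omega> i = field C t \<omega> i k"
      by (simp add: field_def coef_def U_def)
  qed
  have err: "err t \<omega> \<nu> = H (field C t \<omega>) \<nu> - expectation (\<lambda>\<omega>. H (field C t \<omega>) \<nu>)" for t \<omega>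
    by (simp add: err_def U_field)
  have err_meas [measurable]: "(\<lambda>\<omega>. err t \<omega> \<nu>) \<in> borel_measurable M" for t
    unfolding err using measurable_h_field by (intro borel_measurable_diff) auto
  show ?thesis
  proof (intro conjI allI impI)
    \<comment> \<open>The estimator is a finite linear combination of the errors with deterministic
      weights, plus a constant, so it is measurable for every T, whatever value
      \<open>matinv\<close> takes.\<close>
    show "{\<omega>\<in>space M. sqrt (\<Sum>j<p T. (ols T (p T) (x T)
        (\<lambda>t. (\<Sum>i<p T. x T t i * beta T \<nu> i) + err t \<omega> \<nu>) j - beta T \<nu> j)\<^sup>2) > \<eta>} \<in> sets M" for T \<eta>
      unfolding ols_def by measurable
    show "(\<lambda>T. prob {\<omega>\<in>space M. sqrt (\<Sum>j<p T. (ols T (p T) (x T)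
        (\<lambda>t. (\<Sum>i<p T. x T t i * beta T \<nu> i) + err t \<omega> \<nu>) j - beta T \<nu> j)\<^sup>2) > \<eta>}) \<longlonglongrightarrow> 0"
      if "\<eta> > 0" for \<eta>
    proof (rule ols_consistent[where e = "\<lambda>t \<omega>. err t \<omega> \<nu>" and \<beta> = "\<lambda>T. beta T \<nu>" and B = Bx and a = a1])
      show "(\<lambda>T. real (p T) / sqrt (real T)) \<longlonglongrightarrow> 0"
        by (rule dimension_over_sqrt_tendsto_0[OF p_lim a])
      show "a1 \<le> k" if "T \<ge> 1" "is_eigenvalue (p T) (\<lambda>i j. gram T (x T) i j / real T) k" for T k
        using spec[OF that] by simp
    qed (use err Bx a1 that in auto)
  qed
qed

end
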